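(* Let $n\ge 2$ and $1\le r\le n-1$. Then the group $\mathcal{O}_{n,r}\cong\mathrm{Out}(G_{n,r})$ of outer automorphisms of the Higman–Thompson group $G_{n,r}$ contains a subgroup isomorphic to Thompson's group $F$.
   Context: Let $X_n=\{0,1,\ldots,n-1\}$ and let $\mathfrak{C}_{n,r}=\{1,\ldots,r\}\times X_n^\omega$ be the disjoint union of $r$ copies of the Cantor space $X_n^\omega$ of infinite sequences over $X_n$. For $i\in\{1,\ldots,r\}$ and a finite word $\gamma$ over $X_n$, the cone $U_{i\gamma}$ is the set of elements $(i,\gamma x)$, $x\in X_n^\omega$. The Higman–Thompson group $G_{n,r}$ is the group of all homeomorphisms $g$ of $\mathfrak{C}_{n,r}$ for which there are two partitions $\{U_{i_1\gamma_1},\ldots,U_{i_k\gamma_k}\}$ and $\{U_{j_1\delta_1},\ldots,U_{j_k\delta_k}\}$ of $\mathfrak{C}_{n,r}$ into the same finite number of cones such that $g(i_s,\gamma_s x)=(j_s,\delta_s x)$ for all $s$ and all $x\in X_n^\omega$. Thompson's group $V$ is $G_{2,1}$. $\mathcal{O}_{n,r}$ denotes the group of transducers isomorphic to $\mathrm{Out}(G_{n,r})$. Thompson's group $F$ is the group of orientation-preserving piecewise linear homeomorphisms of $[0,1]$ with finitely many breakpoints, all at dyadic rationals, and all slopes integer powers of $2$. *)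

theory Defs
  imports
    "HOL-Analysis.Analysis"
    "HOL-Library.Omega_Words_Fun"
    "HOL-Algebra.Bij"
    "HOL-Algebra.Coset"
begin

section \<open>The Cantor space and its cones\<close>

definition infinite_words :: "nat \<Rightarrow> nat word set" where
  "infinite_words n = (UNIV \<rightarrow>\<^sub>E {..<n})"

definition cantor :: "nat \<Rightarrow> nat \<Rightarrow> (nat \<times> nat word) set" where
  "cantor n r = {1..r} \<times> infinite_words n"

definition cantor_topology :: "nat \<Rightarrow> nat \<Rightarrow> (nat \<times> nat word) topology" where
  "cantor_topology n r =
     prod_topology (discrete_topology {1..r})
       (product_topology (\<lambda>_. discrete_topology {..<n}) UNIV)"

lemma topspace_cantor_topology: "topspace (cantor_topology n r) = cantor n r"
  by (simp add: cantor_topology_def cantor_def infinite_words_def)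

text \<open>The pair \<open>(i, \<gamma>)\<close> stands for the address \<open>i\<gamma>\<close>; \<open>\<gamma> \<frown> x\<close> is concatenation.\<close>

definition cone :: "nat \<Rightarrow> nat \<times> nat list \<Rightarrow> (nat \<times> nat word) set" where
  "cone n = (\<lambda>(i, \<gamma>). {(i, \<gamma> \<frown> x) | x. x \<in> infinite_words n})"

definition cone_partition :: "nat \<Rightarrow> nat \<Rightarrow> (nat \<times> nat list) list \<Rightarrow> bool" where
  "cone_partition n r ps \<longleftrightarrow>
     set ps \<subseteq> {1..r} \<times> lists {..<n} \<and>
     distinct (map (cone n) ps) \<and>
     partition_on (cantor n r) (cone n ` set ps)"

section \<open>Higman--Thompson groups\<close>

text \<open>
  As usual in \<open>HOL-Algebra\<close>, self-maps of a set \<open>S\<close> are represented by functions that are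
  extensional on \<open>S\<close>, and the product \<open>g \<otimes> f\<close> in \<open>BijGroup S\<close> is \<open>g \<circ> f\<close>.
\<close>

definition Higman_Thompson ::
    "nat \<Rightarrow> nat \<Rightarrow> (nat \<times> nat word \<Rightarrow> nat \<times> nat word) monoid" where
  "Higman_Thompson n r = BijGroup (cantor n r)
     \<lparr>carrier := {g \<in> Bij (cantor n r).
        homeomorphic_map (cantor_topology n r) (cantor_topology n r) g \<and>
        (\<exists>ps qs. cone_partition n r ps \<and> cone_partition n r qs \<and> length ps = length qs \<and>
           (\<forall>s < length ps. \<forall>x \<in> infinite_words n.
              g (fst (ps ! s), snd (ps ! s) \<frown> x) = (fst (qs ! s), snd (qs ! s) \<frown> x)))}\<rparr>"

section \<open>Outer automorphism groups\<close>

definition inner_automorphisms :: "('a, 'b) monoid_scheme \<Rightarrow> ('a \<Rightarrow> 'a) set" where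
  "inner_automorphisms G =
     {\<lambda>x \<in> carrier G. g \<otimes>\<^bsub>G\<^esub> x \<otimes>\<^bsub>G\<^esub> inv\<^bsub>G\<^esub> g | g. g \<in> carrier G}"

definition Out :: "('a, 'b) monoid_scheme \<Rightarrow> ('a \<Rightarrow> 'a) set monoid" where
  "Out G = AutoGroup G Mod inner_automorphisms G"

section \<open>Thompson's group \<open>F\<close>\<close>

text \<open>
  \<open>B\<close> is a finite set of dyadic rationals containing all breakpoints: \<open>f\<close> is affine, with slope
  a power of \<open>2\<close>, on every open subinterval of the unit interval that avoids \<open>B\<close>.
  (The library's \<open>dyadics\<close> are the non-negative dyadic rationals.)
\<close>

definition Thompson_F :: "(real \<Rightarrow> real) monoid" where
  "Thompson_F = BijGroup {0..1}
     \<lparr>carrier := {f \<in> Bij {0..1}.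
        homeomorphic_map (top_of_set {0..1}) (top_of_set {0..1}) f \<and>
        strict_mono_on {0..1} f \<and>
        (\<exists>B :: real set. finite B \<and> B \<subseteq> dyadics \<and>
           (\<forall>a b. 0 \<le> a \<and> a < b \<and> b \<le> 1 \<and> {a<..<b} \<inter> B = {} \<longrightarrow>
              (\<exists>(k :: int) (c :: real). \<forall>x \<in> {a<..<b}. f x = 2 powi k * x + c)))}\<rparr>"

end

theory Submission
  imports Defs
begin

text \<open>
  The idea is to let \<open>F\<close> act on an infinite word by acting, independently, on infinitely many
  finite pieces of it.

  Number the dyadic rationals in the open unit interval by the finite binary words: a word is a
  path in the tree of standard dyadic subintervals, and it stands for the midpoint of the interval
  that it leads to. An element of \<open>F\<close> permutes the dyadic rationals in \<open>(0, 1)\<close>, so it induces a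
  permutation \<open>\<phi>\<close> of the binary words. It maps all sufficiently small standard dyadic intervals
  affinely onto standard dyadic intervals, which means \<open>\<phi> (u w) = \<phi> u w\<close> for all \<open>w\<close> once \<open>u\<close> is
  long: \<open>\<phi>\<close> is rigid at long words. The construction below applies to every permutation of the
  binary words with this property.

  Now write the binary letters as \<open>0\<close> and \<open>10\<close> inside infinite words over \<open>{0, \<dots>, n-1}\<close>. An
  infinite word splits into blocks of such letters, with separators in between: a separator starts
  where no letter can be read, and it ends after the next \<open>0\<close>. Let \<open>\<phi>\<close> rewrite
  every block and keep the separators. Rigidity gives a meaning to this also when a block is
  infinite. The resulting map \<open>on_blocks \<phi>\<close> is the fixed point of a contraction, and the uniqueness
  of this fixed point makes \<open>\<phi> \<mapsto> on_blocks \<phi>\<close> a homomorphism (\<open>on_blocks_comp\<close>). It acts on each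
  copy of the Cantor space.

  The code is chosen such that \<open>on_blocks \<phi>\<close> is synchronizing: after a long common stretch of
  input, the way in which it continues does not depend on what had been read before. Indeed a
  symbol \<open>\<ge> 2\<close>, or two adjacent nonzero symbols, always lead into a separator, while after a
  stretch without these one is deep inside a block, where \<open>\<phi>\<close> is rigid and just copies
  (\<open>synchronization\<close>). This is why the maps normalize the Higman--Thompson group:
  an element of this group replaces, near each point, one prefix by another and keeps the tail, and
  \<open>on_blocks \<phi>\<close> treats both tails alike (\<open>block_map_conj\<close>).

  Conjugation therefore maps \<open>F\<close> to the automorphisms of the Higman--Thompson group. Only the
  identity commutes with the whole Higman--Thompson group, so an automorphism obtained in this way
  is inner only if the conjugating map itself belongs to the group
  (\<open>normalizer_embeds_in_Out\<close>). A map that rewrites all blocks cannot replace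
  just one prefix near a point, unless \<open>\<phi>\<close> is the identity (\<open>on_blocks_prefix_replacing\<close>). Hence
  \<open>F\<close> embeds in the outer automorphism group.
\<close>

(* Prefixes are handled as lists throughout; these two rules would break them up symbol by symbol. *)
declare build_cons [simp del] build_append [simp del]

section \<open>Rigid permutations of the binary words\<close>

definition rigid :: "(bool list \<Rightarrow> bool list) \<Rightarrow> bool list \<Rightarrow> bool" where
  "rigid \<phi> u \<longleftrightarrow> (\<forall>w. \<phi> (u @ w) = \<phi> u @ w)"

text \<open>
  These are the permutations of the vertices of the infinite binary tree that preserve the tree
  structure outside a finite set (the group of quasi-automorphisms of the tree).
\<close>
definition tree_maps :: "(bool list \<Rightarrow> bool list) set" where
  "tree_maps = {\<phi>. bij \<phi> \<and> (\<exists>M. \<forall>u. M \<le> length u \<longrightarrow> rigid \<phi> u)}"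

lemma rigid_id [simp]: "rigid id u"
  by (simp add: rigid_def)

lemma rigidD: "rigid \<phi> u \<Longrightarrow> \<phi> (u @ w) = \<phi> u @ w"
  by (simp add: rigid_def)

text \<open>
  Since only finitely many words are short, only finitely many can have short images.
\<close>
lemma inj_long_images:
  assumes "inj \<phi>"
  shows "\<exists>M. \<forall>u :: bool list. M \<le> length u \<longrightarrow> N \<le> length (\<phi> u :: bool list)"
proof -
  have "finite {w :: bool list. length w \<le> N}"
    using finite_lists_length_le[of "UNIV :: bool set" N] by simp
  then have "finite {w :: bool list. length w < N}"
    by (rule rev_finite_subset) auto
  then have fin: "finite (\<phi> -` {w. length w < N})"
    using assms by (rule finite_vimageI)
  obtain M where M: "\<And>u. u \<in> \<phi> -` {w. length w < N} \<Longrightarrow> length u < M"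
    using finite_nat_set_iff_bounded[of "length ` (\<phi> -` {w. length w < N})"] fin by auto
  show ?thesis
    using M by (metis leD linorder_not_less mem_Collect_eq vimageI)
qed

lemma eventually_rigid_comp:
  assumes "\<phi> \<in> tree_maps" "\<psi> \<in> tree_maps"
  shows "\<exists>M. \<forall>u. M \<le> length u \<longrightarrow> rigid \<psi> u \<and> rigid \<phi> (\<psi> u)"
proof -
  obtain M1 M2 where M1: "\<And>u. M1 \<le> length u \<Longrightarrow> rigid \<phi> u"
    and M2: "\<And>u. M2 \<le> length u \<Longrightarrow> rigid \<psi> u"
    using assms by (auto simp: tree_maps_def)
  obtain M3 where M3: "\<And>u. M3 \<le> length u \<Longrightarrow> M1 \<le> length (\<psi> u)"
    using inj_long_images[of \<psi> M1] assms by (auto simp: tree_maps_def bij_def)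
  have "rigid \<psi> u \<and> rigid \<phi> (\<psi> u)" if "max M2 M3 \<le> length u" for u
    using that M1 M2 M3 by simp
  then show ?thesis by blast
qed

lemma id_tree_maps: "id \<in> tree_maps"
  by (simp add: tree_maps_def)

lemma tree_maps_comp:
  assumes "\<phi> \<in> tree_maps" "\<psi> \<in> tree_maps"
  shows "\<phi> \<circ> \<psi> \<in> tree_maps"
proof -
  obtain M where "\<And>u. M \<le> length u \<Longrightarrow> rigid \<psi> u \<and> rigid \<phi> (\<psi> u)"
    using eventually_rigid_comp[OF assms] by blast
  then have "\<And>u. M \<le> length u \<Longrightarrow> rigid (\<phi> \<circ> \<psi>) u"
    by (simp add: rigid_def)
  then show ?thesis
    using assms unfolding tree_maps_def by (blast intro: bij_comp)
qed

text \<open>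
  If \<open>\<phi>\<close> is rigid at the preimage \<open>u\<close> of \<open>v\<close>, then \<open>\<phi> (u w) = v w\<close>, and this is rigidity of the
  inverse at \<open>v\<close>. All long \<open>v\<close> have long preimages.
\<close>
lemma tree_maps_inv:
  assumes \<phi>: "\<phi> \<in> tree_maps"
  shows "inv_into UNIV \<phi> \<in> tree_maps"
proof -
  have bij: "bij \<phi>" using \<phi> by (simp add: tree_maps_def)
  obtain M where M: "\<And>u. M \<le> length u \<Longrightarrow> rigid \<phi> u"
    using \<phi> by (auto simp: tree_maps_def)
  obtain M' where M': "\<And>v. M' \<le> length v \<Longrightarrow> M \<le> length (inv_into UNIV \<phi> v)"
    using inj_long_images[of "inv_into UNIV \<phi>" M] bij by (auto simp: bij_imp_bij_inv bij_is_inj)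
  have "rigid (inv_into UNIV \<phi>) v" if "M' \<le> length v" for v
    unfolding rigid_def
  proof
    fix w
    have "\<phi> (inv_into UNIV \<phi> v @ w) = \<phi> (inv_into UNIV \<phi> v) @ w"
      by (rule rigidD[OF M[OF M'[OF that]]])
    then have "\<phi> (inv_into UNIV \<phi> v @ w) = v @ w" by (simp add: bij bij_is_surj surj_f_inv_f)
    then show "inv_into UNIV \<phi> (v @ w) = inv_into UNIV \<phi> v @ w" by (metis bij bij_is_inj inv_f_f)
  qed
  then show ?thesis using bij bij_imp_bij_inv by (auto simp: tree_maps_def)
qed

section \<open>Letters and separators in infinite words\<close>

text \<open>
  The two code words both end at their only \<open>0\<close>. Hence a \<open>0\<close> always completes a letter or a
  separator, and the parse cannot get out of step.
\<close>
definition encode :: "bool list \<Rightarrow> nat list" where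
  "encode w = concat (map (\<lambda>b. if b then [1, 0] else [0]) w)"

lemma encode_simps [simp]:
  "encode [] = []"
  "encode (True # w) = [1, 0] @ encode w"
  "encode (False # w) = [0] @ encode w"
  "encode (u @ w) = encode u @ encode w"
  by (simp_all add: encode_def)

lemma length_encode: "length w \<le> length (encode w)"
proof (induction w)
  case (Cons b w) then show ?case by (cases b) auto
qed simp

text \<open>
  The complement of the words that begin with a letter, \<open>0\<close> or \<open>10\<close>.
\<close>
definition separator_start :: "nat word \<Rightarrow> bool" where
  "separator_start z \<longleftrightarrow> 2 \<le> z 0 \<or> z 0 = 1 \<and> z 1 \<noteq> 0"

lemma conc_at_0 [simp]: "((a # u) \<frown> x) 0 = a"
  by (simp add: conc_def)

lemma conc_Cons_1 [simp]: "((a # u) \<frown> x) 1 = (u \<frown> x) 0"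
  by (simp add: conc_def)

lemma conc_Cons_eq_iff [simp]: "(a # u) \<frown> x = (b # v) \<frown> y \<longleftrightarrow> a = b \<and> u \<frown> x = v \<frown> y"
  using concat_eq[of "[a]" "[b]" "u \<frown> x" "v \<frown> y"] by (simp del: concat_eq)

lemma not_separator_encode: "w \<noteq> [] \<Longrightarrow> \<not> separator_start (encode w \<frown> z)"
proof (cases w)
  case (Cons b v) then show ?thesis by (cases b) (auto simp: separator_start_def)
qed simp

text \<open>
  The letters form a prefix code, so the letters of \<open>u\<close> and \<open>w\<close> can be compared one at a time. The
  disjunction gives the two reasons why \<open>w\<close> does not run out first: a separator cannot be read as
  a letter, or \<open>w\<close> is long enough by assumption.
\<close>
lemma encode_conc_prefix:
  assumes "encode u \<frown> y = encode w \<frown> z" "separator_start z \<or> length u \<le> length w"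
  shows "\<exists>v. w = u @ v \<and> y = encode v \<frown> z"
  using assms
proof (induction u arbitrary: w)
  case Nil then show ?case by simp
next
  case (Cons b u)
  then have "w \<noteq> []"
    using not_separator_encode[of "b # u" y] by (cases "w = []") auto
  then obtain c w' where w: "w = c # w'" by (cases w) auto
  have "b = c \<and> encode u \<frown> y = encode w' \<frown> z"
    using Cons.prems(1) unfolding w by (cases b; cases c) auto
  with Cons.IH[of w'] Cons.prems(2) w show ?case by auto
qed

lemma encode_conc_unique:
  assumes "encode u \<frown> y = encode w \<frown> z" "separator_start y" "separator_start z"
  shows "u = w \<and> y = z"
proof -
  obtain v where v: "w = u @ v" "y = encode v \<frown> z"
    using encode_conc_prefix assms by blast
  with not_separator_encode[of v z] assms(2) show ?thesis by (cases "v = []") auto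
qed

lemma encode_parse:
  "(\<exists>u y. length u = M \<and> x = encode u \<frown> y) \<or>
   (\<exists>u z. length u < M \<and> separator_start z \<and> x = encode u \<frown> z)"
proof (induction M)
  case 0
  show ?case by (rule disjI1, rule exI[of _ "[]"], rule exI[of _ x]) simp
next
  case (Suc M)
  then consider u y where "length u = M" "x = encode u \<frown> y"
    | u z where "length u < M" "separator_start z" "x = encode u \<frown> z" by blast
  then show ?case
  proof cases
    case 1
    consider "separator_start y" | "y 0 = 0" | "y 0 = 1" "y 1 = 0"
      by (force simp: separator_start_def)
    then show ?thesis
    proof cases
      case 1
      with \<open>length u = M\<close> \<open>x = _\<close> show ?thesis by auto
    next
      case 2
      have "y = [0] \<frown> suffix 1 y"
        using prefix_suffix[of y 1] 2 by (simp del: prefix_suffix[symmetric] add: subsequence_def)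
      then have "encode u \<frown> y = encode u \<frown> [0] \<frown> suffix 1 y" by (rule arg_cong)
      then have "x = encode (u @ [False]) \<frown> suffix 1 y" using \<open>x = _\<close> by simp
      then show ?thesis using 1 by (metis length_append_singleton)
    next
      case 3
      have "y = [1, 0] \<frown> suffix 2 y"
        using prefix_suffix[of y 2] 3
        by (simp del: prefix_suffix[symmetric] add: subsequence_def numeral_2_eq_2)
      then have "encode u \<frown> y = encode u \<frown> [1, 0] \<frown> suffix 2 y" by (rule arg_cong)
      then have "x = encode (u @ [True]) \<frown> suffix 2 y" using \<open>x = _\<close> by simp
      then show ?thesis using 1 by (metis length_append_singleton)
    qed
  next
    case 2
    have "length u < Suc M" using 2(1) by simp
    with 2(2,3) show ?thesis by blast
  qed
qed

text \<open>
  The treatment of a separator: it is copied up to and including its first \<open>0\<close>, after which \<open>k\<close>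
  takes over. A separator without \<open>0\<close> extends to infinity. Ending separators at a \<open>0\<close>, and
  not after a fixed number of symbols, is what makes a run of nonzero symbols synchronizing.
\<close>
definition after_zero :: "(nat word \<Rightarrow> nat word) \<Rightarrow> nat word \<Rightarrow> nat word" where
  "after_zero k z =
     (if \<exists>i. z i = 0
      then let i = LEAST i. z i = 0 in prefix (Suc i) z \<frown> k (suffix (Suc i) z) else z)"

lemma after_zero_none: "(\<And>i. z i \<noteq> 0) \<Longrightarrow> after_zero k z = z"
  unfolding after_zero_def by (simp only: if_False simp_thms ex_simps)

lemma after_zero_conc:
  assumes "0 \<notin> set d"
  shows "after_zero k ((d @ [0]) \<frown> x) = (d @ [0]) \<frown> k x"
proof -
  have ex: "((d @ [0]) \<frown> x) (length d) = 0" by simp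
  have "(LEAST i. ((d @ [0]) \<frown> x) i = 0) = length d"
  proof (rule Least_equality, rule ex)
    fix i assume i: "((d @ [0]) \<frown> x) i = 0"
    show "length d \<le> i"
    proof (rule ccontr)
      assume "\<not> length d \<le> i"
      then have "d ! i = 0" using i by (simp add: nth_append)
      with \<open>\<not> length d \<le> i\<close> assms show False by (metis linorder_not_le nth_mem)
    qed
  qed
  then have L: "Suc (LEAST i. ((d @ [0]) \<frown> x) i = 0) = length (d @ [0])" by simp
  have "\<exists>i. ((d @ [0]) \<frown> x) i = 0" using ex by blast
  then show ?thesis
    unfolding after_zero_def Let_def L
    by (simp only: if_True prefix_conc_length suffix_conc_length)
qed

lemma zero_cases:
  fixes z :: "nat word"
  obtains "\<And>i. z i \<noteq> 0" | d x where "0 \<notin> set d" "z = (d @ [0]) \<frown> x"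
proof (cases "\<exists>i. z i = 0")
  case True
  define i where "i = (LEAST i. z i = 0)"
  have i: "z i = 0" unfolding i_def using True by (rule LeastI_ex)
  have "0 \<notin> set (prefix i z)"
    using not_less_Least[of _ "\<lambda>i. z i = 0"] unfolding i_def set_subsequence by fastforce
  moreover have "z = (prefix i z @ [0]) \<frown> suffix (Suc i) z"
    using prefix_suffix[of z "Suc i"] i by (simp del: prefix_suffix[symmetric])
  ultimately show thesis by (rule that(2))
qed (use that in auto)

lemma after_zero_nonzero:
  assumes "0 \<notin> set d"
  shows "after_zero k (d \<frown> z) = d \<frown> after_zero k z"
proof (cases z rule: zero_cases)
  case 1
  then have "(d \<frown> z) i \<noteq> 0" for i
  proof (cases "i < length d")
    case True
    then have "d ! i \<in> set d" by simp
    with assms True show ?thesis by (metis conc_fst)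
  qed (use 1 in simp)
  with 1 show ?thesis by (simp add: after_zero_none)
next
  case (2 e x)
  then show ?thesis
    using after_zero_conc[of "d @ e" k x] after_zero_conc[of e k x] assms by simp
qed

lemma after_zero_comp: "after_zero k (after_zero l z) = after_zero (k \<circ> l) z"
  by (cases z rule: zero_cases) (auto simp: after_zero_none after_zero_conc)

lemma after_zero_id: "after_zero id z = z"
  by (cases z rule: zero_cases) (auto simp: after_zero_none after_zero_conc)

text \<open>
  The symbols up to the first \<open>0\<close> decide: the word begins with a letter exactly if \<open>d\<close> is empty
  or consists of a single \<open>1\<close>.
\<close>
lemma separator_start_until_zero:
  assumes "0 \<notin> set d" "separator_start ((d @ [0]) \<frown> x)"
  shows "separator_start ((d @ [0]) \<frown> y)"
  using assms by (cases d; cases "tl d") (auto simp: separator_start_def conc_def)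

lemma separator_after_zero:
  assumes "separator_start z" shows "separator_start (after_zero k z)"
proof (cases z rule: zero_cases)
  case 1 with assms show ?thesis by (simp add: after_zero_none)
next
  case (2 d x)
  then have "separator_start ((d @ [0]) \<frown> k x)"
    using assms separator_start_until_zero by blast
  then show ?thesis using 2 by (simp add: after_zero_conc)
qed

section \<open>Rewriting the first block\<close>

text \<open>
  The block \<open>w\<close> in front of the first separator becomes \<open>\<phi> w\<close>, the separator is copied, and \<open>k\<close>
  treats the rest. A word without separators is one infinite block; there \<open>\<phi>\<close> acts on any
  prefix \<open>u\<close> at which it is rigid, and all choices of \<open>u\<close> give the same result
  (\<open>rigid_same_image\<close>).
\<close>
definition on_first_block ::
    "(bool list \<Rightarrow> bool list) \<Rightarrow> (nat word \<Rightarrow> nat word) \<Rightarrow> nat word \<Rightarrow> nat word" where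
  "on_first_block \<phi> k x =
     (if \<exists>w z. separator_start z \<and> x = encode w \<frown> z
      then THE y. \<exists>w z. separator_start z \<and> x = encode w \<frown> z \<and>
                        y = encode (\<phi> w) \<frown> after_zero k z
      else THE y. \<exists>u z. rigid \<phi> u \<and> x = encode u \<frown> z \<and> y = encode (\<phi> u) \<frown> z)"

lemma on_first_block_finite:
  assumes "separator_start z"
  shows "on_first_block \<phi> k (encode w \<frown> z) = encode (\<phi> w) \<frown> after_zero k z"
proof -
  have ex: "\<exists>w' z'. separator_start z' \<and> encode w \<frown> z = encode w' \<frown> z'" using assms by blast
  have "(THE y. \<exists>w' z'. separator_start z' \<and> encode w \<frown> z = encode w' \<frown> z' \<and>
                        y = encode (\<phi> w') \<frown> after_zero k z') = encode (\<phi> w) \<frown> after_zero k z"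
    by (rule the_equality) (use assms in blast, use encode_conc_unique assms in blast)
  then show ?thesis unfolding on_first_block_def using ex by simp
qed

lemma rigid_same_image:
  assumes "rigid \<phi> u" "rigid \<phi> u'" "encode u \<frown> z = encode u' \<frown> z'"
  shows "encode (\<phi> u) \<frown> z = encode (\<phi> u') \<frown> z'"
proof -
  have *: "encode (\<phi> u) \<frown> z = encode (\<phi> u') \<frown> z'"
    if "rigid \<phi> u" "length u \<le> length u'" "encode u \<frown> z = encode u' \<frown> z'" for u u' z z'
  proof -
    obtain v where "u' = u @ v" "z = encode v \<frown> z'"
      using encode_conc_prefix[OF \<open>encode u \<frown> z = encode u' \<frown> z'\<close>] \<open>length u \<le> length u'\<close> by blast
    then show ?thesis using rigidD[OF \<open>rigid \<phi> u\<close>] by simp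
  qed
  show ?thesis
    using *[of u u' z z'] *[of u' u z' z] assms by (cases "length u \<le> length u'") auto
qed

lemma on_first_block_infinite:
  assumes "\<nexists>w z'. separator_start z' \<and> encode u \<frown> z = encode w \<frown> z'" "rigid \<phi> u"
  shows "on_first_block \<phi> k (encode u \<frown> z) = encode (\<phi> u) \<frown> z"
proof -
  have "(THE y. \<exists>u' z'. rigid \<phi> u' \<and> encode u \<frown> z = encode u' \<frown> z' \<and> y = encode (\<phi> u') \<frown> z')
      = encode (\<phi> u) \<frown> z"
    by (rule the_equality) (use assms in blast, use rigid_same_image assms in metis)
  then show ?thesis unfolding on_first_block_def using assms(1) by auto
qed

lemma no_separator_suffix:
  "(\<exists>w z'. separator_start z' \<and> encode u \<frown> z = encode w \<frown> z') \<longleftrightarrow>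
   (\<exists>w z'. separator_start z' \<and> z = encode w \<frown> z')"
proof
  assume "\<exists>w z'. separator_start z' \<and> encode u \<frown> z = encode w \<frown> z'"
  then show "\<exists>w z'. separator_start z' \<and> z = encode w \<frown> z'"
    using encode_conc_prefix by blast
next
  assume "\<exists>w z'. separator_start z' \<and> z = encode w \<frown> z'"
  then obtain w z' where wz: "separator_start z'" "z = encode w \<frown> z'" by blast
  then have "encode u \<frown> z = encode (u @ w) \<frown> z'" by simp
  then show "\<exists>w z'. separator_start z' \<and> encode u \<frown> z = encode w \<frown> z'" using wz by blast
qed

lemma first_block_cases:
  obtains w z where "separator_start z" "x = encode w \<frown> z"
  | u z where "length u = M" "x = encode u \<frown> z" "\<nexists>w z'. separator_start z' \<and> x = encode w \<frown> z'"
  using encode_parse[of M x] by blast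

text \<open>
  Once the part of the block that has been read is rigid, its image is settled and the rest of the
  block is copied. This is what \<open>on_first_block id\<close> does.
\<close>
lemma on_first_block_rigid:
  assumes "rigid \<phi> u"
  shows "on_first_block \<phi> k (encode u \<frown> y) = encode (\<phi> u) \<frown> on_first_block id k y"
proof (cases "\<exists>w z. separator_start z \<and> y = encode w \<frown> z")
  case True
  then obtain w z where wz: "separator_start z" "y = encode w \<frown> z" by blast
  then have "encode u \<frown> y = encode (u @ w) \<frown> z" by simp
  then show ?thesis
    using on_first_block_finite[OF wz(1)] wz(2) rigidD[OF assms] by (simp del: encode_simps(4)) simp
next
  case False
  then have "on_first_block id k (encode [] \<frown> y) = encode [] \<frown> y"
    by (subst on_first_block_infinite) auto
  moreover have "on_first_block \<phi> k (encode u \<frown> y) = encode (\<phi> u) \<frown> y"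
    by (rule on_first_block_infinite) (use False no_separator_suffix assms in auto)
  ultimately show ?thesis by simp
qed

text \<open>
  Rewriting a block does not touch the separator behind it, so the image is split into blocks at
  the images of the old separators, and the second map finds the blocks that the first one left.
\<close>
lemma on_first_block_comp:
  assumes "\<phi> \<in> tree_maps" "\<psi> \<in> tree_maps"
  shows "on_first_block \<phi> k (on_first_block \<psi> l x) = on_first_block (\<phi> \<circ> \<psi>) (k \<circ> l) x"
proof -
  obtain M where M: "\<And>u. M \<le> length u \<Longrightarrow> rigid \<psi> u \<and> rigid \<phi> (\<psi> u)"
    using eventually_rigid_comp[OF assms] by blast
  show ?thesis
  proof (cases x rule: first_block_cases[where M = M])
    case (1 w z)
    then show ?thesis
      by (simp add: on_first_block_finite separator_after_zero after_zero_comp)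
  next
    case (2 u z)
    have r: "rigid \<psi> u" "rigid \<phi> (\<psi> u)" using M 2(1) by auto
    then have r': "rigid (\<phi> \<circ> \<psi>) u" by (simp add: rigid_def)
    show ?thesis
      using 2 r r' no_separator_suffix by (simp add: on_first_block_infinite)
  qed
qed

lemma on_first_block_id: "on_first_block id id = id"
proof
  fix x
  show "on_first_block id id x = id x"
  proof (cases x rule: first_block_cases[where M = 0])
    case (1 w z)
    then show ?thesis by (simp add: on_first_block_finite after_zero_id)
  next
    case (2 u z)
    have "on_first_block id id (encode u \<frown> z) = encode (id u) \<frown> z"
      using 2 by (intro on_first_block_infinite) auto
    with 2 show ?thesis by simp
  qed
qed

section \<open>Rewriting every block\<close>

definition agree_upto :: "nat \<Rightarrow> nat word \<Rightarrow> nat word \<Rightarrow> bool" where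
  "agree_upto i x y \<longleftrightarrow> (\<forall>j < i. x j = y j)"

lemma agree_upto_conc:
  assumes "agree_upto i x y" shows "agree_upto (length u + i) (u \<frown> x) (u \<frown> y)"
  using assms by (auto simp: agree_upto_def conc_def)

lemma agree_upto_mono: "agree_upto i x y \<Longrightarrow> j \<le> i \<Longrightarrow> agree_upto j x y"
  by (simp add: agree_upto_def)

lemma agree_upto_refl [simp]: "agree_upto i x x"
  by (simp add: agree_upto_def)

text \<open>
  A separator contains at least its final \<open>0\<close>, so \<open>k\<close> and \<open>l\<close> only get to work after one
  symbol of output.
\<close>
lemma on_first_block_contracts:
  assumes \<phi>: "\<phi> \<in> tree_maps" and kl: "\<And>x. agree_upto i (k x) (l x)"
  shows "agree_upto (Suc i) (on_first_block \<phi> k x) (on_first_block \<phi> l x)"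
proof -
  obtain M where M: "\<And>u. M \<le> length u \<Longrightarrow> rigid \<phi> u"
    using \<phi> by (auto simp: tree_maps_def)
  have az: "agree_upto (Suc i) (after_zero k z) (after_zero l z)" for z
  proof (cases z rule: zero_cases)
    case 1 then show ?thesis by (simp add: after_zero_none)
  next
    case (2 d y)
    show ?thesis
      unfolding 2(2) after_zero_conc[OF 2(1)]
      by (rule agree_upto_mono[OF agree_upto_conc[OF kl]]) simp
  qed
  show ?thesis
  proof (cases x rule: first_block_cases[where M = M])
    case (1 w z)
    show ?thesis
      unfolding 1(2) on_first_block_finite[OF 1(1)]
      by (rule agree_upto_mono[OF agree_upto_conc[OF az]]) simp
  next
    case (2 u z)
    then show ?thesis using M by (simp add: on_first_block_infinite)
  qed
qed

text \<open>
  Banach's fixed point theorem for operators that gain one symbol of agreement: after \<open>i + 1\<close>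
  rounds the symbol at position \<open>i\<close> no longer depends on the starting point.
\<close>
lemma contractive_fixpoint:
  fixes \<Theta> :: "(nat word \<Rightarrow> nat word) \<Rightarrow> nat word \<Rightarrow> nat word"
  assumes contr: "\<And>i k l x. (\<And>y. agree_upto i (k y) (l y)) \<Longrightarrow> agree_upto (Suc i) (\<Theta> k x) (\<Theta> l x)"
  defines "h \<equiv> \<lambda>x i. (\<Theta> ^^ Suc i) id x i"
  shows "\<Theta> h = h" and "\<Theta> k = k \<Longrightarrow> k = h"
proof -
  have iter: "agree_upto m ((\<Theta> ^^ m) k x) ((\<Theta> ^^ m) l x)" for m k l x
  proof (induction m arbitrary: x)
    case 0 then show ?case by (simp add: agree_upto_def)
  next
    case (Suc m) then show ?case using contr by simp
  qed
  have h: "agree_upto m (h x) ((\<Theta> ^^ m) id x)" for m x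
    unfolding agree_upto_def
  proof (intro allI impI)
    fix j assume "j < m"
    then obtain d where d: "m = Suc j + d" using less_iff_Suc_add by auto
    have "(\<Theta> ^^ m) id = (\<Theta> ^^ Suc j) ((\<Theta> ^^ d) id)"
      unfolding d funpow_add by simp
    with iter[of "Suc j" id x "(\<Theta> ^^ d) id"]
    show "h x j = (\<Theta> ^^ m) id x j"
      unfolding h_def agree_upto_def by simp
  qed
  show "\<Theta> h = h"
  proof (intro ext)
    fix x i
    have "agree_upto (Suc i) (\<Theta> h x) (\<Theta> ((\<Theta> ^^ i) id) x)" by (rule contr) (rule h)
    then show "\<Theta> h x i = h x i" unfolding agree_upto_def h_def by simp
  qed
  show "k = h" if "\<Theta> k = k"
  proof (intro ext)
    fix x i
    have "(\<Theta> ^^ m) k = k" for m by (induction m) (use that in auto)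
    with iter[of "Suc i" k x id] show "k x i = h x i"
      unfolding agree_upto_def h_def by (metis lessI)
  qed
qed

definition on_blocks :: "(bool list \<Rightarrow> bool list) \<Rightarrow> nat word \<Rightarrow> nat word" where
  "on_blocks \<phi> x i = (on_first_block \<phi> ^^ Suc i) id x i"

lemma on_blocks_fixpoint:
  assumes "\<phi> \<in> tree_maps"
  shows "on_first_block \<phi> (on_blocks \<phi>) = on_blocks \<phi>"
    and "on_first_block \<phi> k = k \<Longrightarrow> k = on_blocks \<phi>"
proof -
  have eq: "on_blocks \<phi> = (\<lambda>x i. (on_first_block \<phi> ^^ Suc i) id x i)"
    by (intro ext) (simp add: on_blocks_def)
  show "on_first_block \<phi> (on_blocks \<phi>) = on_blocks \<phi>"
    unfolding eq by (rule contractive_fixpoint(1)[OF on_first_block_contracts[OF assms]])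
  show "k = on_blocks \<phi>" if "on_first_block \<phi> k = k"
    unfolding eq
    by (rule contractive_fixpoint(2)) (use that on_first_block_contracts[OF assms] in auto)
qed

text \<open>
  The composition satisfies the fixed point equation for \<open>\<phi> \<circ> \<psi>\<close>.
\<close>
lemma on_blocks_comp:
  assumes "\<phi> \<in> tree_maps" "\<psi> \<in> tree_maps"
  shows "on_blocks (\<phi> \<circ> \<psi>) = on_blocks \<phi> \<circ> on_blocks \<psi>"
proof (rule on_blocks_fixpoint(2)[symmetric, OF tree_maps_comp[OF assms]], rule ext)
  fix x
  show "on_first_block (\<phi> \<circ> \<psi>) (on_blocks \<phi> \<circ> on_blocks \<psi>) x = (on_blocks \<phi> \<circ> on_blocks \<psi>) x"
    using on_first_block_comp[OF assms, of "on_blocks \<phi>" "on_blocks \<psi>" x]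
    by (simp add: on_blocks_fixpoint assms)
qed

lemma on_blocks_id: "on_blocks id = id"
  using on_blocks_fixpoint(2)[OF id_tree_maps on_first_block_id] by simp

lemma on_blocks_finite:
  assumes "\<phi> \<in> tree_maps" "separator_start z"
  shows "on_blocks \<phi> (encode w \<frown> z) = encode (\<phi> w) \<frown> after_zero (on_blocks \<phi>) z"
  using on_first_block_finite[OF assms(2)] on_blocks_fixpoint(1)[OF assms(1)] by metis

lemma on_blocks_rigid:
  assumes "\<phi> \<in> tree_maps" "rigid \<phi> u"
  shows "on_blocks \<phi> (encode u \<frown> y) = encode (\<phi> u) \<frown> on_first_block id (on_blocks \<phi>) y"
  using on_first_block_rigid[OF assms(2)] on_blocks_fixpoint(1)[OF assms(1)] by metis

lemma conc_in_infinite_words [simp]: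
  "u \<frown> x \<in> infinite_words n \<longleftrightarrow> u \<in> lists {..<n} \<and> x \<in> infinite_words n"
proof -
  have *: "z \<in> infinite_words n \<longleftrightarrow> range z \<subseteq> {..<n}" for z :: "nat word"
    by (auto simp: infinite_words_def)
  show ?thesis unfolding * range_conc by auto
qed

lemma encode_in_lists: "2 \<le> n \<Longrightarrow> encode w \<in> lists {..<n}"
proof (induction w)
  case (Cons b w) then show ?case by (cases b) auto
qed simp

lemma on_first_block_infinite_words:
  assumes "2 \<le> n" "\<phi> \<in> tree_maps" "\<And>x. x \<in> infinite_words n \<Longrightarrow> k x \<in> infinite_words n"
    and x: "x \<in> infinite_words n"
  shows "on_first_block \<phi> k x \<in> infinite_words n"
proof -
  obtain M where M: "\<And>u. M \<le> length u \<Longrightarrow> rigid \<phi> u"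
    using assms(2) by (auto simp: tree_maps_def)
  have az: "after_zero k z \<in> infinite_words n" if "z \<in> infinite_words n" for z
    using that by (cases z rule: zero_cases) (auto simp: after_zero_none after_zero_conc assms(3))
  show ?thesis
  proof (cases x rule: first_block_cases[where M = M])
    case (1 w z)
    then show ?thesis
      using x az encode_in_lists[OF assms(1)] by (simp add: on_first_block_finite)
  next
    case (2 u z)
    then show ?thesis
      using x M encode_in_lists[OF assms(1)] by (simp add: on_first_block_infinite)
  qed
qed

lemma on_blocks_infinite_words:
  assumes "2 \<le> n" "\<phi> \<in> tree_maps" "x \<in> infinite_words n"
  shows "on_blocks \<phi> x \<in> infinite_words n"
proof -
  have *: "(on_first_block \<phi> ^^ m) id x \<in> infinite_words n" if "x \<in> infinite_words n" for m x
    using that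
  proof (induction m arbitrary: x)
    case (Suc m) then show ?case by (simp add: on_first_block_infinite_words assms)
  qed simp
  have "on_blocks \<phi> x i < n" for i
    using *[OF assms(3), of "Suc i"] unfolding on_blocks_def infinite_words_def by auto
  then show ?thesis by (auto simp: infinite_words_def)
qed

lemma agree_upto_split:
  assumes "agree_upto (length u + i) (u \<frown> x) y"
  shows "\<exists>x'. y = u \<frown> x' \<and> agree_upto i x x'"
proof -
  have "prefix (length u) y = u"
  proof (rule nth_equalityI)
    fix j assume "j < length (prefix (length u) y)"
    then have "j < length u" by simp
    moreover have "(u \<frown> x) j = y j"
      using assms \<open>j < length u\<close> unfolding agree_upto_def by (metis trans_less_add1)
    ultimately show "prefix (length u) y ! j = u ! j" by simp
  qed simp
  then have y: "y = u \<frown> suffix (length u) y"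
    using prefix_suffix[of y "length u"] by (simp del: prefix_suffix[symmetric])
  have "agree_upto i x (suffix (length u) y)"
    unfolding agree_upto_def
  proof (intro allI impI)
    fix j assume "j < i"
    then have "(u \<frown> x) (length u + j) = y (length u + j)"
      using assms unfolding agree_upto_def by (meson add_less_cancel_left)
    then show "x j = suffix (length u) y j" by simp
  qed
  with y show ?thesis by blast
qed

lemma after_zero_agree:
  assumes nz: "\<And>i. z i \<noteq> 0" and ag: "agree_upto m z z'"
  shows "agree_upto m z (after_zero k z')"
proof -
  have "prefix m z = prefix m z'"
    using ag by (auto simp: agree_upto_def subsequence_def)
  then have z': "z' = prefix m z \<frown> suffix m z'" by simp
  have z: "z = prefix m z \<frown> suffix m z" by simp
  have "0 \<notin> set (prefix m z)" using nz by (metis imageE set_subsequence)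
  then have "after_zero k z' = prefix m z \<frown> after_zero k (suffix m z')"
    by (subst z') (rule after_zero_nonzero)
  then show ?thesis by (auto simp: agree_upto_def)
qed

text \<open>
  By induction on the number \<open>i\<close> of symbols of output. A block that is followed by a separator
  with a \<open>0\<close> produces at least one symbol before the map starts afresh. In the other cases a long
  prefix of the input already determines as much of the output as desired: because a separator
  without \<open>0\<close> is copied, or because long words have long images under \<open>\<phi>\<close>.
\<close>
lemma on_blocks_continuous:
  assumes \<phi>: "\<phi> \<in> tree_maps"
  shows "\<exists>N. \<forall>y. agree_upto N x y \<longrightarrow> agree_upto i (on_blocks \<phi> x) (on_blocks \<phi> y)"
proof (induction i arbitrary: x)
  case 0 then show ?case by (simp add: agree_upto_def)
next
  case (Suc i)
  obtain M1 M2 where M1: "\<And>u. M1 \<le> length u \<Longrightarrow> rigid \<phi> u"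
    and M2: "\<And>u. M2 \<le> length u \<Longrightarrow> Suc i \<le> length (\<phi> u)"
    using \<phi> inj_long_images[of \<phi> "Suc i"] by (auto simp: tree_maps_def bij_is_inj)
  define M where "M = max M1 M2"
  have M: "rigid \<phi> u \<and> Suc i \<le> length (\<phi> u)" if "M \<le> length u" for u
    using that M1 M2 by (simp add: M_def)
  show ?case
  proof (cases x rule: first_block_cases[where M = M])
    case (1 w z)
    note wz = this
    show ?thesis
    proof (cases z rule: zero_cases)
      case 1
      have "agree_upto (Suc i) (on_blocks \<phi> x) (on_blocks \<phi> y)"
        if ag: "agree_upto (length (encode w) + (i + 2)) x y" for y
      proof -
        obtain z' where z': "y = encode w \<frown> z'" "agree_upto (i + 2) z z'"
          using agree_upto_split[of "encode w" "i + 2" z y] ag unfolding wz(2) by blast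
        have "z 0 = z' 0" "z 1 = z' 1"
          using z'(2) unfolding agree_upto_def by simp_all
        then have sep': "separator_start z'"
          using wz(1) unfolding separator_start_def by simp
        have "agree_upto (i + 2) z (after_zero (on_blocks \<phi>) z')"
          by (rule after_zero_agree[OF 1 z'(2)])
        then have "agree_upto (length (encode (\<phi> w)) + (i + 2)) (encode (\<phi> w) \<frown> z)
            (encode (\<phi> w) \<frown> after_zero (on_blocks \<phi>) z')"
          by (rule agree_upto_conc)
        then have "agree_upto (Suc i) (encode (\<phi> w) \<frown> z)
            (encode (\<phi> w) \<frown> after_zero (on_blocks \<phi>) z')"
          by (rule agree_upto_mono) simp
        then show ?thesis
          unfolding wz(2) z'(1) on_blocks_finite[OF \<phi> wz(1)] on_blocks_finite[OF \<phi> sep']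
            after_zero_none[OF 1] .
      qed
      then show ?thesis by blast
    next
      case (2 d x')
      obtain N where N: "\<And>y. agree_upto N x' y \<Longrightarrow> agree_upto i (on_blocks \<phi> x') (on_blocks \<phi> y)"
        using Suc by blast
      have sep: "separator_start ((d @ [0]) \<frown> y)" for y
        by (rule separator_start_until_zero[OF 2(1) wz(1)[unfolded 2(2)]])
      have eq: "on_blocks \<phi> ((encode w @ d @ [0]) \<frown> y) = (encode (\<phi> w) @ d @ [0]) \<frown> on_blocks \<phi> y" for y
        using on_blocks_finite[OF \<phi> sep, of w y]
        unfolding after_zero_conc[OF 2(1)] by (simp only: conc_conc)
      have "agree_upto (Suc i) (on_blocks \<phi> x) (on_blocks \<phi> y)"
        if ag: "agree_upto (length (encode w @ d @ [0]) + N) x y" for y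
      proof -
        have x: "x = (encode w @ d @ [0]) \<frown> x'" using wz(2) 2(2) by simp
        obtain y' where y': "y = (encode w @ d @ [0]) \<frown> y'" "agree_upto N x' y'"
          using agree_upto_split[of "encode w @ d @ [0]" N x' y] ag unfolding x by blast
        show ?thesis
          unfolding x y'(1) eq
          by (rule agree_upto_mono[OF agree_upto_conc[OF N[OF y'(2)]]]) simp
      qed
      then show ?thesis by blast
    qed
  next
    case (2 u z)
    have "agree_upto (Suc i) (on_blocks \<phi> x) (on_blocks \<phi> y)"
      if ag: "agree_upto (length (encode u) + 0) x y" for y
    proof -
      obtain z' where z': "y = encode u \<frown> z'"
        using agree_upto_split[of "encode u" 0 z y] ag unfolding 2(2) by blast
      have u: "rigid \<phi> u" "Suc i \<le> length (\<phi> u)" using M 2(1) by auto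
      have "Suc i \<le> length (encode (\<phi> u))" using u(2) length_encode le_trans by blast
      then show ?thesis
        unfolding 2(2) z' on_blocks_rigid[OF \<phi> u(1)] by (simp add: agree_upto_def)
    qed
    then show ?thesis by blast
  qed
qed

section \<open>Synchronization\<close>

lemma on_blocks_inv:
  assumes "\<phi> \<in> tree_maps"
  shows "on_blocks (inv_into UNIV \<phi>) (on_blocks \<phi> x) = x" "on_blocks \<phi> (on_blocks (inv_into UNIV \<phi>) x) = x"
proof -
  have bij: "bij \<phi>" using assms by (simp add: tree_maps_def)
  then have "inv_into UNIV \<phi> \<circ> \<phi> = id" "\<phi> \<circ> inv_into UNIV \<phi> = id"
    using bij_is_inj[OF bij] bij_is_surj[OF bij] by (simp_all add: surj_iff)
  then have "on_blocks (inv_into UNIV \<phi>) \<circ> on_blocks \<phi> = id"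
    "on_blocks \<phi> \<circ> on_blocks (inv_into UNIV \<phi>) = id"
    using on_blocks_comp[OF tree_maps_inv[OF assms] assms]
      on_blocks_comp[OF assms tree_maps_inv[OF assms]] on_blocks_id by simp_all
  then show "on_blocks (inv_into UNIV \<phi>) (on_blocks \<phi> x) = x"
    "on_blocks \<phi> (on_blocks (inv_into UNIV \<phi>) x) = x"
    by (simp_all only: fun_eq_iff comp_apply id_apply) simp_all
qed

text \<open>
  After reading \<open>p\<close>, the output \<open>P\<close> is settled, and the map continues as if it had only read \<open>u\<close>.
\<close>
definition pending :: "(bool list \<Rightarrow> bool list) \<Rightarrow> nat list \<Rightarrow> nat list \<Rightarrow> bool" where
  "pending \<phi> p u \<longleftrightarrow> (\<exists>P. \<forall>y. on_blocks \<phi> (p \<frown> y) = P \<frown> on_blocks \<phi> (u \<frown> y))"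

text \<open>
  After reading \<open>p\<close>, the map is inside a separator.
\<close>
definition copying :: "(bool list \<Rightarrow> bool list) \<Rightarrow> nat list \<Rightarrow> bool" where
  "copying \<phi> p \<longleftrightarrow> (\<exists>P. \<forall>y. on_blocks \<phi> (p \<frown> y) = P \<frown> after_zero (on_blocks \<phi>) y)"

lemma pending_append:
  assumes "pending \<phi> p u" shows "pending \<phi> (p @ s) (u @ s)"
proof -
  obtain P where P: "\<And>y. on_blocks \<phi> (p \<frown> y) = P \<frown> on_blocks \<phi> (u \<frown> y)"
    using assms by (auto simp: pending_def)
  have "on_blocks \<phi> ((p @ s) \<frown> y) = P \<frown> on_blocks \<phi> ((u @ s) \<frown> y)" for y
    using P[of "s \<frown> y"] by (simp only: conc_conc)
  then show ?thesis unfolding pending_def by blast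
qed

text \<open>
  With \<open>d\<close> the separator has begun, so the block \<open>w\<close> is complete and its image can be written.
\<close>
lemma pending_separator:
  assumes \<phi>: "\<phi> \<in> tree_maps" and p: "pending \<phi> p (encode w @ d)"
    and d: "0 \<notin> set d" "\<And>y. separator_start (d \<frown> y)"
  shows "copying \<phi> p"
proof -
  obtain P where P: "\<And>y. on_blocks \<phi> (p \<frown> y) = P \<frown> on_blocks \<phi> ((encode w @ d) \<frown> y)"
    using p by (auto simp: pending_def)
  have "on_blocks \<phi> ((encode w @ d) \<frown> y) = (encode (\<phi> w) @ d) \<frown> after_zero (on_blocks \<phi>) y" for y
    using on_blocks_finite[OF \<phi> d(2), of w y] unfolding after_zero_nonzero[OF d(1)]
    by (simp only: conc_conc)
  then have "on_blocks \<phi> (p \<frown> y) = (P @ encode (\<phi> w) @ d) \<frown> after_zero (on_blocks \<phi>) y" for y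
    unfolding P by (simp only: conc_conc)
  then show ?thesis unfolding copying_def by blast
qed

lemma copying_append:
  assumes "copying \<phi> p" "d \<noteq> 0" shows "copying \<phi> (p @ [d])"
proof -
  obtain P where P: "\<And>y. on_blocks \<phi> (p \<frown> y) = P \<frown> after_zero (on_blocks \<phi>) y"
    using assms by (auto simp: copying_def)
  have "on_blocks \<phi> ((p @ [d]) \<frown> y) = (P @ [d]) \<frown> after_zero (on_blocks \<phi>) y" for y
    using P[of "[d] \<frown> y"] after_zero_nonzero[of "[d]" "on_blocks \<phi>" y] assms(2)
    by (simp add: conc_conc)
  then show ?thesis unfolding copying_def by blast
qed

lemma copying_zero:
  assumes "copying \<phi> p" shows "pending \<phi> (p @ [0]) (encode [])"
proof -
  obtain P where P: "\<And>y. on_blocks \<phi> (p \<frown> y) = P \<frown> after_zero (on_blocks \<phi>) y"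
    using assms by (auto simp: copying_def)
  have "on_blocks \<phi> ((p @ [0]) \<frown> y) = (P @ [0]) \<frown> on_blocks \<phi> (encode [] \<frown> y)" for y
    using P[of "[0] \<frown> y"] after_zero_conc[of "[]" "on_blocks \<phi>" y]
    by (simp add: conc_conc)
  then show ?thesis unfolding pending_def by blast
qed

lemma separator_start_2: "2 \<le> d \<Longrightarrow> separator_start ([d] \<frown> y)"
  by (simp add: separator_start_def)

lemma separator_start_1: "d \<noteq> 0 \<Longrightarrow> separator_start ([1, d] \<frown> y)"
  by (simp add: separator_start_def)

text \<open>
  The three states: at the end of a letter inside a block, after the \<open>1\<close> of a possible letter \<open>10\<close>,
  and inside a separator.
\<close>
lemma reading_states:
  assumes \<phi>: "\<phi> \<in> tree_maps"
  shows "(\<exists>w. pending \<phi> p (encode w)) \<or> (\<exists>w. pending \<phi> p (encode w @ [1])) \<or> copying \<phi> p"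
proof (induction p rule: rev_induct)
  case Nil
  have "pending \<phi> [] (encode [])" unfolding pending_def by (rule exI[of _ "[]"]) simp
  then show ?case by blast
next
  case (snoc d p)
  consider w where "pending \<phi> p (encode w)" | w where "pending \<phi> p (encode w @ [1])" | "copying \<phi> p"
    using snoc by blast
  then show ?case
  proof cases
    case 1
    note p = pending_append[OF this, of "[d]"]
    consider "d = 0" | "d = 1" | "2 \<le> d" by linarith
    then show ?thesis
    proof cases
      case 1
      then have "pending \<phi> (p @ [d]) (encode (w @ [False]))" using p by simp
      then show ?thesis by blast
    next
      case 3
      then show ?thesis using pending_separator[OF \<phi> p _ separator_start_2[OF 3]] by simp
    qed (use p in blast)
  next
    case 2
    note p = pending_append[OF this, of "[d]"]
    show ?thesis
    proof (cases "d = 0")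
      case True
      then have "pending \<phi> (p @ [d]) (encode (w @ [True]))" using p by simp
      then show ?thesis by blast
    next
      case False
      have "pending \<phi> (p @ [d]) (encode w @ [1, d])" using p by simp
      then show ?thesis
        using pending_separator[OF \<phi> _ _ separator_start_1[OF False]] False by simp
    qed
  next
    case 3
    then show ?thesis using copying_append copying_zero by (cases "d = 0") blast+
  qed
qed

lemma pending_after_zero:
  assumes \<phi>: "\<phi> \<in> tree_maps"
  shows "\<exists>w. pending \<phi> (p @ [0]) (encode w)"
proof -
  have "pending \<phi> (p @ [0]) (encode (w @ [False]))" if "pending \<phi> p (encode w)" for w
    using pending_append[OF that, of "[0]"] by simp
  moreover have "pending \<phi> (p @ [0]) (encode (w @ [True]))" if "pending \<phi> p (encode w @ [1])" for w
    using pending_append[OF that, of "[0]"] by simp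
  ultimately show ?thesis using reading_states[OF \<phi>, of p] copying_zero by blast
qed

lemma copying_after_large:
  assumes \<phi>: "\<phi> \<in> tree_maps" and d: "2 \<le> d"
  shows "copying \<phi> (p @ [d])"
proof -
  have "copying \<phi> (p @ [d])" if "pending \<phi> p (encode w)" for w
    using pending_separator[OF \<phi> pending_append[OF that] _ separator_start_2[OF d]] d by simp
  moreover have "copying \<phi> (p @ [d])" if "pending \<phi> p (encode w @ [1])" for w
    using pending_separator[OF \<phi> _ _ separator_start_1[of d]] pending_append[OF that, of "[d]"] d
    by simp
  ultimately show ?thesis using reading_states[OF \<phi>, of p] copying_append d by fastforce
qed

lemma copying_after_two:
  assumes \<phi>: "\<phi> \<in> tree_maps" and d: "d \<noteq> 0" "e \<noteq> 0"
  shows "copying \<phi> (p @ [d, e])"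
proof -
  consider w where "pending \<phi> (p @ [d]) (encode w)" | w where "pending \<phi> (p @ [d]) (encode w @ [1])"
    | "copying \<phi> (p @ [d])"
    using reading_states[OF \<phi>, of "p @ [d]"] by blast
  have "copying \<phi> (p @ [d, e])" if "d = 1"
  proof -
    have "copying \<phi> (p @ [1, e])" if "pending \<phi> p (encode w)" for w
      using pending_separator[OF \<phi> pending_append[OF that] _ separator_start_1[OF d(2)]] d by simp
    moreover have "copying \<phi> (p @ [1, e])" if "pending \<phi> p (encode w @ [1])" for w
    proof -
      have "copying \<phi> (p @ [1])"
        using pending_separator[OF \<phi> _ _ separator_start_1[of 1]] pending_append[OF that, of "[1]"]
        by simp
      then show ?thesis using copying_append[of \<phi> "p @ [1]" e] d by simp
    qed
    moreover have "copying \<phi> (p @ [1, e])" if "copying \<phi> p"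
      using copying_append[of \<phi> "p @ [1]" e] copying_append[OF that, of 1] d by simp
    ultimately show ?thesis using reading_states[OF \<phi>, of p] that by blast
  qed
  moreover have "copying \<phi> (p @ [d, e])" if "2 \<le> d"
    using copying_append[OF copying_after_large[OF \<phi> that] d(2), of p] by simp
  ultimately show ?thesis using d(1) by linarith
qed

lemma subsequence_two: "prefix (i + 2) x = prefix i x @ [x i, x (Suc i)]"
  by (simp add: numeral_2_eq_2)

text \<open>
  The continuation \<open>k\<close> depends on \<open>x\<close> but not on \<open>p\<close>. A symbol \<open>\<ge> 2\<close> and two adjacent nonzero
  symbols lead into a separator from each of the three states. If \<open>x\<close> contains neither, then it
  contains a \<open>0\<close> and consists of letters behind it. At this \<open>0\<close> the map is at the end of a letter of
  some block \<open>w\<close>, where \<open>w\<close> depends on \<open>p\<close>; but after \<open>M\<close> more letters the block has a rigid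
  prefix, and the rest of it is copied whatever \<open>w\<close> was.
\<close>
theorem synchronization:
  assumes \<phi>: "\<phi> \<in> tree_maps"
  shows "\<exists>m k. \<forall>p. \<exists>P. \<forall>y. on_blocks \<phi> ((p @ prefix m x) \<frown> y) = P \<frown> k y"
proof -
  have copy: ?thesis if "\<And>p. copying \<phi> (p @ prefix m x)" for m
    using that unfolding copying_def by blast
  consider i where "2 \<le> x i" | i where "x i \<noteq> 0" "x (Suc i) \<noteq> 0"
    | "\<And>i. x i < 2" "\<And>i. x i = 0 \<or> x (Suc i) = 0"
    by (meson not_le)
  then show ?thesis
  proof cases
    case (1 i)
    have "copying \<phi> ((p @ prefix i x) @ [x i])" for p
      by (rule copying_after_large[OF \<phi> 1])
    then show ?thesis using copy[of "Suc i"] by simp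
  next
    case (2 i)
    have "copying \<phi> ((p @ prefix i x) @ [x i, x (Suc i)])" for p
      by (rule copying_after_two[OF \<phi> 2])
    then show ?thesis using copy[of "i + 2"] by (simp only: subsequence_two append_assoc)
  next
    case 3
    obtain M where M: "\<And>u. M \<le> length u \<Longrightarrow> rigid \<phi> u"
      using \<phi> by (auto simp: tree_maps_def)
    obtain j where j: "x j = 0" using 3(2) by blast
    let ?s = "suffix (Suc j) x"
    have not_sep: "\<not> separator_start z" if "?s = encode u \<frown> z" for u z
    proof -
      have "z i = x (Suc j + length (encode u) + i)" for i
        using fun_cong[OF that, of "length (encode u) + i"] by (simp add: add.assoc)
      then have "z 0 < 2" "z 0 = 0 \<or> z (Suc 0) = 0"
        using 3(1) 3(2)[of "Suc j + length (encode u)"] by simp_all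
      then show ?thesis by (auto simp: separator_start_def)
    qed
    then obtain u z where u: "length u = M" "?s = encode u \<frown> z"
      using encode_parse[of M ?s] by blast
    (* Read up to the zero at position j, and then M letters. *)
    let ?m = "Suc j + length (encode u)"
    have pre: "prefix ?m x = prefix j x @ [0] @ encode u"
    proof -
      have "x = (prefix j x @ [0]) \<frown> ?s"
        using prefix_suffix[of x "Suc j"] j by (simp del: prefix_suffix[symmetric])
      then have "x = (prefix j x @ [0] @ encode u) \<frown> z" using u(2) by simp
      then show ?thesis
        using prefix_conc_length[of "prefix j x @ [0] @ encode u" z] by simp
    qed
    have "\<exists>P. \<forall>y. on_blocks \<phi> ((p @ prefix ?m x) \<frown> y) = P \<frown> on_first_block id (on_blocks \<phi>) y" for p
    proof -
      obtain w P where P: "\<And>y. on_blocks \<phi> (((p @ prefix j x) @ [0]) \<frown> y)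
          = P \<frown> on_blocks \<phi> (encode w \<frown> y)"
        using pending_after_zero[OF \<phi>, of "p @ prefix j x"] unfolding pending_def by blast
      have r: "rigid \<phi> (w @ u)" using M u(1) by simp
      have "on_blocks \<phi> ((p @ prefix ?m x) \<frown> y)
          = (P @ encode (\<phi> (w @ u))) \<frown> on_first_block id (on_blocks \<phi>) y" for y
        using P[of "encode u \<frown> y"] on_blocks_rigid[OF \<phi> r, of y] unfolding pre
        by (simp only: conc_conc append_assoc encode_simps)
      then show ?thesis by blast
    qed
    then show ?thesis by blast
  qed
qed

lemma const_infinite_words: "c < n \<Longrightarrow> (\<lambda>_. c) \<in> infinite_words n"
  by (auto simp: infinite_words_def)

lemma on_blocks_eq_id:
  assumes \<phi>: "\<phi> \<in> tree_maps" and n: "2 \<le> n"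
    and id: "\<And>y. y \<in> infinite_words n \<Longrightarrow> on_blocks \<phi> y = y"
  shows "\<phi> = id"
proof
  fix w
  let ?c = "(\<lambda>_. 1) :: nat word"
  have c: "?c \<in> infinite_words n" using n by (intro const_infinite_words) simp
  have s: "separator_start ?c" by (simp add: separator_start_def)
  have "encode (\<phi> w) \<frown> ?c = encode w \<frown> ?c"
    using on_blocks_finite[OF \<phi> s, of w] after_zero_none[of ?c]
      id[of "encode w \<frown> ?c"] c encode_in_lists[OF n] by simp
  then show "\<phi> w = id w" using encode_conc_unique s by auto
qed

text \<open>
  After \<open>110\<close> the map starts afresh, whatever has been read. So the assumption yields
  \<open>P \<frown> on_blocks \<phi> y = Q \<frown> y\<close> for all \<open>y\<close>. If \<open>Q\<close> were longer than \<open>P\<close>, then all values of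
  the surjective map \<open>on_blocks \<phi>\<close> would begin with the same symbol; if \<open>P\<close> were longer, then all
  infinite words would. Hence \<open>on_blocks \<phi>\<close> is the identity.
\<close>
lemma on_blocks_prefix_replacing:
  assumes \<phi>: "\<phi> \<in> tree_maps" and n: "2 \<le> n"
    and eq: "\<And>y. y \<in> infinite_words n \<Longrightarrow> on_blocks \<phi> (p \<frown> y) = v \<frown> y"
  shows "\<phi> = id"
proof -
  have "pending \<phi> ((p @ [1, 1]) @ [0]) (encode [])"
    by (rule copying_zero[OF copying_after_two[OF \<phi>]]) simp_all
  then obtain P where P: "\<And>y. on_blocks \<phi> ((p @ [1, 1, 0]) \<frown> y) = P \<frown> on_blocks \<phi> y"
    by (auto simp: pending_def)
  define Q where "Q = v @ [1, 1, 0]"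
  have PQ: "P \<frown> on_blocks \<phi> y = Q \<frown> y" if y: "y \<in> infinite_words n" for y
  proof -
    have "[1, 1, 0] \<frown> y \<in> infinite_words n" using y n by simp
    then show ?thesis
      using eq[of "[1, 1, 0] \<frown> y"] P[of y] unfolding Q_def by (simp only: conc_conc)
  qed
  (* An infinite word that does not begin with a given symbol. *)
  define c :: "nat \<Rightarrow> nat word" where "c a = (\<lambda>_. if a = 0 then 1 else 0)" for a
  have c: "c a \<in> infinite_words n" "c a 0 \<noteq> a" for a
    using n by (auto simp: c_def infinite_words_def)
  have "on_blocks \<phi> y = y" if y: "y \<in> infinite_words n" for y
  proof (cases "length P \<le> length Q")
    case True
    define Q' where "Q' = drop (length P) Q"
    have Q: "Q = take (length P) Q @ Q'" "length (take (length P) Q) = length P"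
      using True by (simp_all add: Q'_def)
    have h: "on_blocks \<phi> y = Q' \<frown> y" if y: "y \<in> infinite_words n" for y
    proof -
      have "P \<frown> on_blocks \<phi> y = take (length P) Q \<frown> Q' \<frown> y"
        using PQ[OF y] Q(1) by simp
      then show ?thesis using Q(2) by (simp del: conc_conc)
    qed
    have "Q' = []"
    proof (cases Q')
      case (Cons a Q'')
      define y where "y = on_blocks (inv_into UNIV \<phi>) (c a)"
      have "y \<in> infinite_words n"
        unfolding y_def by (rule on_blocks_infinite_words[OF n tree_maps_inv[OF \<phi>] c(1)])
      then have "c a = Q' \<frown> y" using h[of y] on_blocks_inv(2)[OF \<phi>, of "c a"] y_def by metis
      then have "c a 0 = a" using Cons by simp
      with c(2) show ?thesis by blast
    qed
    then show ?thesis using h[OF y] by simp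
  next
    case False
    define P' where "P' = drop (length Q) P"
    have P: "P = take (length Q) P @ P'" "length (take (length Q) P) = length Q"
      using False by (simp_all add: P'_def)
    have h: "P' \<frown> on_blocks \<phi> y = y" if y: "y \<in> infinite_words n" for y
    proof -
      have "take (length Q) P \<frown> P' \<frown> on_blocks \<phi> y = Q \<frown> y"
        using PQ[OF y] P(1) by simp
      then show ?thesis using P(2) by (simp del: conc_conc)
    qed
    obtain a P'' where "P' = a # P''" using False by (cases P') (auto simp: P'_def)
    then have "c a 0 = a" using h[OF c(1)[of a]] by (metis conc_at_0)
    with c(2) show ?thesis by blast
  qed
  then show ?thesis by (rule on_blocks_eq_id[OF \<phi> n])
qed

section \<open>Thompson's group F\<close>

definition affine_off :: "real set \<Rightarrow> (real \<Rightarrow> real) \<Rightarrow> bool" where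
  "affine_off B f \<longleftrightarrow>
     (\<forall>a b. 0 \<le> a \<and> a < b \<and> b \<le> 1 \<and> {a<..<b} \<inter> B = {} \<longrightarrow>
        (\<exists>(k :: int) (c :: real). \<forall>x \<in> {a<..<b}. f x = 2 powi k * x + c))"

lemma affine_offD:
  assumes "affine_off B f" "0 \<le> a" "a < b" "b \<le> 1" "{a<..<b} \<inter> B = {}"
  shows "\<exists>(k :: int) (c :: real). \<forall>x \<in> {a<..<b}. f x = 2 powi k * x + c"
  using assms unfolding affine_off_def by meson

text \<open>
  A continuous bijection of the compact interval is a homeomorphism.
\<close>
lemma carrier_Thompson_F_iff:
  "f \<in> carrier Thompson_F \<longleftrightarrow>
     f \<in> Bij {0..1} \<and> strict_mono_on {0..1} f \<and> continuous_on {0..1} f \<and>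
     (\<exists>B. finite B \<and> B \<subseteq> dyadics \<and> affine_off B f)"
proof -
  have "homeomorphic_map (top_of_set {0..1}) (top_of_set {0..1}) f \<longleftrightarrow> continuous_on {0..1} f"
    if f: "f \<in> Bij {0..1}" for f :: "real \<Rightarrow> real"
  proof
    assume "homeomorphic_map (top_of_set {0..1}) (top_of_set {0..1}) f"
    then show "continuous_on {0..1} f"
      using homeomorphic_imp_continuous_map by fastforce
  next
    assume c: "continuous_on {0..1} f"
    have im: "f ` {0..1} = {0..1}" "inj_on f {0..1}"
      using f by (auto simp: Bij_def bij_betw_def)
    show "homeomorphic_map (top_of_set {0..1}) (top_of_set {0..1}) f"
      by (rule continuous_imp_homeomorphic_map)
         (use c im in \<open>auto simp: compact_space_subtopology intro!: Hausdorff_space_subtopology\<close>)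
  qed
  then show ?thesis
    unfolding Thompson_F_def affine_off_def[symmetric] by auto
qed

lemma Thompson_F_mult:
  "f \<in> carrier Thompson_F \<Longrightarrow> g \<in> carrier Thompson_F \<Longrightarrow> f \<otimes>\<^bsub>Thompson_F\<^esub> g = compose {0..1} f g"
  by (simp add: Thompson_F_def BijGroup_def)

lemma dyadic_iff: "x \<in> dyadics \<longleftrightarrow> (\<exists>(m::nat) k. x = real m / 2 ^ k)"
  by (auto simp: dyadics_def)

lemma dyadic_int_iff: "x \<in> dyadics \<longleftrightarrow> 0 \<le> x \<and> (\<exists>(m::int) k. x = real_of_int m / 2 ^ k)"
proof
  assume "x \<in> dyadics"
  then obtain m :: nat and k where "x = real m / 2 ^ k" by (auto simp: dyadic_iff)
  then have "0 \<le> x" "x = real_of_int (int m) / 2 ^ k" by auto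
  then show "0 \<le> x \<and> (\<exists>(m::int) k. x = real_of_int m / 2 ^ k)" by blast
next
  assume "0 \<le> x \<and> (\<exists>(m::int) k. x = real_of_int m / 2 ^ k)"
  then obtain m :: int and k where x: "0 \<le> x" "x = real_of_int m / 2 ^ k" by blast
  have "0 \<le> m"
  proof (rule ccontr)
    assume "\<not> 0 \<le> m"
    then have "x < 0" unfolding x(2) by (intro divide_neg_pos) simp_all
    then show False using x(1) by simp
  qed
  then have "x = real (nat m) / 2 ^ k" using x by simp
  then show "x \<in> dyadics" unfolding dyadic_iff by blast
qed

lemma two_powi_cases:
  obtains m :: nat where "(2::real) powi k = 2 ^ m" | m :: nat where "(2::real) powi k = 1 / 2 ^ m"
proof (cases "k \<ge> 0")
  case True then show thesis using that(1)[of "nat k"] by (simp add: power_int_def)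
next
  case False then show thesis using that(2)[of "nat (- k)"] by (simp add: power_int_def inverse_eq_divide power_one_over)
qed

lemma dyadics_add: "x \<in> dyadics \<Longrightarrow> y \<in> dyadics \<Longrightarrow> x + y \<in> (dyadics :: real set)"
proof -
  assume "x \<in> dyadics" "y \<in> dyadics"
  then obtain m k n l where xy: "x = real m / 2 ^ k" "y = real n / 2 ^ l"
    by (auto simp: dyadic_iff)
  have "x + y = real (m * 2 ^ l + n * 2 ^ k) / 2 ^ (k + l)"
    unfolding xy by (simp add: add_frac_eq power_add)
  then show ?thesis unfolding dyadic_iff by blast
qed

lemma dyadics_minus: "x \<in> dyadics \<Longrightarrow> y \<in> dyadics \<Longrightarrow> y \<le> x \<Longrightarrow> x - y \<in> (dyadics :: real set)"
proof -
  assume "x \<in> dyadics" "y \<in> dyadics" "y \<le> x"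
  then obtain m k n l where xy: "x = real m / 2 ^ k" "y = real n / 2 ^ l"
    by (auto simp: dyadic_iff)
  have "x - y = real_of_int (int m * 2 ^ l - int n * 2 ^ k) / 2 ^ (k + l)"
    unfolding xy by (simp add: diff_frac_eq power_add)
  moreover have "0 \<le> x - y" using \<open>y \<le> x\<close> by simp
  ultimately show ?thesis unfolding dyadic_int_iff by blast
qed

lemma dyadics_scale: "x \<in> dyadics \<Longrightarrow> 2 powi k * x \<in> (dyadics :: real set)"
proof -
  assume "x \<in> dyadics"
  then obtain m l where x: "x = real m / 2 ^ l" by (auto simp: dyadic_iff)
  show ?thesis
  proof (cases k rule: two_powi_cases)
    case (1 j)
    then have "2 powi k * x = real (m * 2 ^ j) / 2 ^ l" using x by simp
    then show ?thesis unfolding dyadic_iff by blast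
  next
    case (2 j)
    then have "2 powi k * x = real m / 2 ^ (l + j)" using x by (simp add: power_add)
    then show ?thesis unfolding dyadic_iff by blast
  qed
qed

lemma affine_on_closure:
  fixes f :: "real \<Rightarrow> real"
  assumes cont: "continuous_on {a..b} f" and ab: "a < b"
    and eq: "\<And>x. x \<in> {a<..<b} \<Longrightarrow> f x = s * x + c" and x: "x \<in> {a..b}"
  shows "f x = s * x + c"
proof -
  have cl: "closure {a<..<b} = {a..b}" using ab by (rule closure_greaterThanLessThan)
  have "f x - s * x = c"
    by (rule continuous_constant_on_closure[where S = "{a<..<b}" and f = "\<lambda>x. f x - s * x"])
       (use cont eq x in \<open>auto simp: cl intro!: continuous_intros\<close>)
  then show ?thesis by simp
qed

lemma bounded_denominator:
  assumes "finite B" "B \<subseteq> (dyadics :: real set)"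
  shows "\<exists>N. \<forall>x \<in> B. \<exists>m :: nat. x = real m / 2 ^ N"
  using assms
proof (induction B)
  case (insert x B)
  then obtain N where N: "\<And>x. x \<in> B \<Longrightarrow> \<exists>m :: nat. x = real m / 2 ^ N" by auto
  obtain m k where x: "x = real m / 2 ^ k" using insert.prems by (auto simp: dyadic_iff)
  have "\<exists>m :: nat. y = real m / 2 ^ (N + k)" if "y \<in> insert x B" for y
  proof (cases "y = x")
    case True
    then have "y = real (m * 2 ^ N) / 2 ^ (N + k)" using x by (simp add: power_add)
    then show ?thesis by blast
  next
    case False
    then have "y \<in> B" using that by simp
    then obtain l :: nat where "y = real l / 2 ^ N" using N by blast
    then have "y = real (l * 2 ^ k) / 2 ^ (N + k)" by (simp add: power_add)
    then show ?thesis by blast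
  qed
  then show ?case by blast
qed simp

text \<open>
  The finitely many breakpoints lie on one dyadic grid. By continuity the affine formulas hold up
  to the end points of the cells.
\<close>
lemma Thompson_F_grid:
  assumes f: "f \<in> carrier Thompson_F"
  shows "\<exists>N. \<forall>j < 2 ^ N. \<exists>k c. \<forall>x \<in> {real j / 2 ^ N .. real (Suc j) / 2 ^ N}. f x = 2 powi k * x + c"
proof -
  obtain B where B: "finite B" "B \<subseteq> dyadics" and
    affB: "affine_off B f"
    using f unfolding carrier_Thompson_F_iff by blast
  have cont: "continuous_on {0..1} f" using f by (simp add: carrier_Thompson_F_iff)
  obtain N where N: "\<And>x. x \<in> B \<Longrightarrow> \<exists>m :: nat. x = real m / 2 ^ N"
    using bounded_denominator[OF B] by blast
  show ?thesis
  proof (intro exI[of _ N] allI impI)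
    fix j :: nat assume j: "j < 2 ^ N"
    let ?a = "real j / 2 ^ N" and ?b = "real (Suc j) / 2 ^ N"
    have ab: "0 \<le> ?a" "?a < ?b" by (simp_all add: divide_strict_right_mono)
    have "real (Suc j) \<le> 2 ^ N" using j by (metis Suc_leI of_nat_le_iff of_nat_numeral of_nat_power)
    then have b: "?b \<le> 1" by simp
    have "{?a<..<?b} \<inter> B = {}"
    proof (rule ccontr)
      assume "{?a<..<?b} \<inter> B \<noteq> {}"
      then obtain z where z: "?a < z" "z < ?b" "z \<in> B" by (meson disjoint_iff greaterThanLessThan_iff)
      obtain m :: nat where "z = real m / 2 ^ N" using N[OF z(3)] by blast
      with z have "?a < real m / 2 ^ N" "real m / 2 ^ N < ?b" by simp_all
      then have "j < m" "m < Suc j" by (simp_all add: divide_less_cancel del: of_nat_Suc)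
      then show False by simp
    qed
    then obtain k c where kc: "\<And>x. x \<in> {?a<..<?b} \<Longrightarrow> f x = 2 powi k * x + c"
      using affine_offD[OF affB ab b] by blast
    have "continuous_on {?a..?b} f"
      by (rule continuous_on_subset[OF cont]) (use ab b in auto)
    then have "\<forall>x \<in> {?a..?b}. f x = 2 powi k * x + c"
      using affine_on_closure[OF _ ab(2) kc] by blast
    then show "\<exists>(k :: int) c. \<forall>x \<in> {?a..?b}. f x = 2 powi k * x + c" by blast
  qed
qed

lemma strict_mono_bij_unit_interval:
  fixes f :: "real \<Rightarrow> real"
  assumes f: "f \<in> Bij {0..1}" and mono: "strict_mono_on {0..1} f"
  shows "f 0 = 0" "f 1 = 1"
proof -
  have im: "f ` {0..1} = {0..1}" using f by (auto simp: Bij_def bij_betw_def)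
  have "0 \<in> f ` {0..1}" "1 \<in> f ` {0..1}" by (simp_all add: im)
  then obtain x y where x: "x \<in> {0..1}" "f x = 0" and y: "y \<in> {0..1}" "f y = 1"
    unfolding image_iff by metis
  have "f 0 \<in> f ` {0..1}" "f 1 \<in> f ` {0..1}" by (auto intro!: imageI)
  then have "0 \<le> f 0" "f 1 \<le> 1" by (simp_all add: im)
  moreover have "f 0 \<le> f x" "f y \<le> f 1"
    using x(1) y(1) strict_mono_on_leD[OF mono, of 0 x] strict_mono_on_leD[OF mono, of y 1]
    by simp_all
  ultimately show "f 0 = 0" "f 1 = 1" using x y by auto
qed

lemma grid_cell:
  assumes x: "x \<in> {0..1 :: real}"
  shows "\<exists>j. j < 2 ^ N \<and> x \<in> {real j / 2 ^ N .. real (Suc j) / 2 ^ N}"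
proof (cases "x = 1")
  case True
  have "Suc (2 ^ N - 1) = (2 ^ N :: nat)" by simp
  then have "real (Suc (2 ^ N - 1)) = 2 ^ N" by (metis of_nat_numeral of_nat_power)
  moreover have "real (2 ^ N - 1) \<le> 2 ^ N" by (simp add: of_nat_diff)
  ultimately have "2 ^ N - 1 < (2 ^ N :: nat) \<and>
      x \<in> {real (2 ^ N - 1) / 2 ^ N .. real (Suc (2 ^ N - 1)) / 2 ^ N}"
    using True by simp
  then show ?thesis by blast
next
  case False
  let ?j = "nat \<lfloor>x * 2 ^ N\<rfloor>"
  have lt: "x * 2 ^ N < 2 ^ N" using False x by simp
  have "0 \<le> x * 2 ^ N" using x by simp
  then have j: "real ?j \<le> x * 2 ^ N" "x * 2 ^ N < real (Suc ?j)" by linarith+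
  then have "real ?j < 2 ^ N" using lt by linarith
  then have "?j < 2 ^ N" by (metis of_nat_less_iff of_nat_numeral of_nat_power)
  moreover have "real ?j / 2 ^ N \<le> x" "x \<le> real (Suc ?j) / 2 ^ N"
    using j by (simp_all add: pos_divide_le_eq pos_le_divide_eq del: of_nat_Suc)
  ultimately show ?thesis by (metis atLeastAtMost_iff)
qed

text \<open>
  Starting from \<open>f 0 = 0\<close>, one reaches \<open>x\<close> through the cells of the grid, and in each of them
  \<open>f\<close> multiplies a dyadic increment by a power of \<open>2\<close>.
\<close>
lemma Thompson_F_dyadic:
  assumes f: "f \<in> carrier Thompson_F" and x: "x \<in> {0..1}" "x \<in> dyadics"
  shows "f x \<in> dyadics"
proof -
  obtain N where N: "\<And>j. j < 2 ^ N \<Longrightarrow>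
      \<exists>k c. \<forall>x \<in> {real j / 2 ^ N .. real (Suc j) / 2 ^ N}. f x = 2 powi k * x + c"
    using Thompson_F_grid[OF f] by blast
  have fB: "f \<in> Bij {0..1}" "strict_mono_on {0..1} f" using f by (auto simp: carrier_Thompson_F_iff)
  have step: "f x \<in> dyadics"
    if j: "j < 2 ^ N" "f (real j / 2 ^ N) \<in> dyadics" and
      x: "x \<in> {real j / 2 ^ N .. real (Suc j) / 2 ^ N}" "x \<in> dyadics" for j x
  proof -
    let ?a = "real j / 2 ^ N"
    obtain k c where kc: "\<And>x. x \<in> {?a..real (Suc j) / 2 ^ N} \<Longrightarrow> f x = 2 powi k * x + c"
      using N[OF j(1)] by blast
    have "?a \<in> dyadics" by (auto simp: dyadic_iff)
    then have "x - ?a \<in> dyadics" using dyadics_minus x by auto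
    then have "f ?a + 2 powi k * (x - ?a) \<in> dyadics" using j(2) dyadics_add dyadics_scale by blast
    moreover have "?a \<in> {?a..real (Suc j) / 2 ^ N}" by (simp add: divide_right_mono)
    then have "f x = f ?a + 2 powi k * (x - ?a)" using kc[of x] kc[of ?a] x by (simp add: algebra_simps)
    ultimately show ?thesis by simp
  qed
  have grid: "f (real j / 2 ^ N) \<in> dyadics" if "j \<le> 2 ^ N" for j
    using that
  proof (induction j)
    case 0
    have "(0::real) \<in> dyadics" using real_in_dyadics[of 0] by simp
    then show ?case using strict_mono_bij_unit_interval(1)[OF fB] by simp
  next
    case (Suc j)
    have j: "j < 2 ^ N" "f (real j / 2 ^ N) \<in> dyadics" using Suc by simp_all
    have "real (Suc j) / 2 ^ N \<in> {real j / 2 ^ N..real (Suc j) / 2 ^ N}"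
      by (simp add: divide_right_mono)
    moreover have "real (Suc j) / 2 ^ N \<in> dyadics" unfolding dyadic_iff by blast
    ultimately show ?case by (rule step[OF j])
  qed
  obtain j :: nat where j: "j < 2 ^ N" "x \<in> {real j / 2 ^ N .. real (Suc j) / 2 ^ N}"
    using grid_cell[OF x(1)] by blast
  show ?thesis using step[OF j(1) grid j(2) x(2)] j(1) by simp
qed

text \<open>
  The breakpoints of the inverse are the images of breakpoints, which are dyadic again.
\<close>
lemma Thompson_F_inverse:
  assumes f: "f \<in> carrier Thompson_F"
  shows "restrict (inv_into {0..1} f) {0..1} \<in> carrier Thompson_F"
proof -
  let ?I = "{0..1} :: real set"
  define g where "g = restrict (inv_into ?I f) ?I"
  have fB: "f \<in> Bij ?I" and mono: "strict_mono_on ?I f" and cont: "continuous_on ?I f"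
    using f by (auto simp: carrier_Thompson_F_iff)
  obtain B where B: "finite B" "B \<subseteq> dyadics" and
    affB: "affine_off B f"
    using f unfolding carrier_Thompson_F_iff by blast
  have im: "f ` ?I = ?I" "inj_on f ?I" using fB by (auto simp: Bij_def bij_betw_def)
  have g: "f (g y) = y" "g y \<in> ?I" if "y \<in> ?I" for y
    using that im f_inv_into_f[of y f ?I] inv_into_into[of y f ?I] by (simp_all add: g_def)
  have gf: "g (f x) = x" if "x \<in> ?I" for x
    using inv_into_f_f[OF im(2) that] im(1) that by (metis g_def imageI restrict_apply')
  have gmono: "strict_mono_on ?I g"
  proof (rule strict_mono_onI)
    fix r s :: real assume rs: "r \<in> ?I" "s \<in> ?I" "r < s"
    show "g r < g s"
    proof (rule ccontr)
      assume "\<not> g r < g s"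
      then have "f (g s) \<le> f (g r)"
        using strict_mono_on_leD[OF mono] g rs by (meson linorder_not_le)
      then show False using g rs by simp
    qed
  qed
  have gcont: "continuous_on ?I g"
    using continuous_on_inv[OF cont, of g] gf im(1) by simp
  have aff_g: "affine_off (f ` (B \<inter> ?I)) g"
    unfolding affine_off_def
  proof (intro allI impI, elim conjE)
    fix a b :: real assume ab: "0 \<le> a" "a < b" "b \<le> 1" "{a<..<b} \<inter> f ` (B \<inter> ?I) = {}"
    have abI: "a \<in> ?I" "b \<in> ?I" using ab by auto
    have between: "g y \<in> {g a<..<g b}" if "y \<in> {a<..<b}" for y
      using that strict_mono_onD[OF gmono] abI by simp
    have "{g a<..<g b} \<inter> B = {}"
    proof (rule ccontr)
      assume "{g a<..<g b} \<inter> B \<noteq> {}"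
      then obtain z where z: "g a < z" "z < g b" "z \<in> B" by auto
      have zI: "z \<in> ?I" using z g(2)[OF abI(1)] g(2)[OF abI(2)] by auto
      have "f (g a) < f z" "f z < f (g b)"
        using strict_mono_onD[OF mono] g(2) abI zI z by auto
      then have "f z \<in> {a<..<b}" using g(1) abI by simp
      then show False using ab(4) z(3) zI by blast
    qed
    then obtain k c where kc: "\<And>x. x \<in> {g a<..<g b} \<Longrightarrow> f x = 2 powi k * x + c"
      using affine_offD[OF affB, of "g a" "g b"] g(2)[OF abI(1)] g(2)[OF abI(2)] strict_mono_onD[OF gmono abI ab(2)]
      by auto
    have "g y = 2 powi (- k) * y + (- (2 powi (- k) * c))" if y: "y \<in> {a<..<b}" for y
    proof -
      have "y = 2 powi k * g y + c" using kc[OF between[OF y]] g(1)[of y] y ab by auto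
      then have "g y * 2 powi k = y - c" by (metis add_diff_cancel_right' mult.commute)
      then have "g y = (y - c) / 2 powi k" by (subst nonzero_eq_divide_eq) simp_all
      then show ?thesis
        unfolding power_int_minus by (simp add: divide_inverse algebra_simps)
    qed
    then show "\<exists>(k :: int) (c :: real). \<forall>y \<in> {a<..<b}. g y = 2 powi k * y + c" by blast
  qed
  have "finite (f ` (B \<inter> ?I))" "f ` (B \<inter> ?I) \<subseteq> dyadics"
    using B Thompson_F_dyadic[OF f] by auto
  then show ?thesis
    unfolding carrier_Thompson_F_iff
    using restrict_inv_into_Bij[OF fB, folded g_def] gmono gcont aff_g
    unfolding g_def[symmetric] by blast
qed

lemma Thompson_F_compose:
  assumes f: "f \<in> carrier Thompson_F" and g: "g \<in> carrier Thompson_F"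
  shows "compose {0..1} g f \<in> carrier Thompson_F"
proof -
  let ?I = "{0..1} :: real set"
  define f' where "f' = restrict (inv_into ?I f) ?I"
  have f': "f' \<in> carrier Thompson_F" unfolding f'_def by (rule Thompson_F_inverse[OF f])
  have fB: "f \<in> Bij ?I" and fm: "strict_mono_on ?I f" and fc: "continuous_on ?I f"
    and gB: "g \<in> Bij ?I" and gm: "strict_mono_on ?I g" and gc: "continuous_on ?I g"
    using f g by (auto simp: carrier_Thompson_F_iff)
  have im: "f ` ?I = ?I" "inj_on f ?I" using fB by (auto simp: Bij_def bij_betw_def)
  have fI: "f x \<in> ?I" if "x \<in> ?I" for x using im that by blast
  obtain B where B: "finite B" "B \<subseteq> dyadics" and
    affB: "affine_off B f"
    using f unfolding carrier_Thompson_F_iff by blast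
  obtain C where C: "finite C" "C \<subseteq> dyadics" and
    affC: "affine_off C g"
    using g unfolding carrier_Thompson_F_iff by blast
  let ?D = "B \<union> f' ` (C \<inter> ?I)"
  have "finite ?D" "?D \<subseteq> dyadics"
    using B C Thompson_F_dyadic[OF f'] by auto
  moreover have "affine_off ?D (compose ?I g f)"
    unfolding affine_off_def
  proof (intro allI impI, elim conjE)
    fix a b :: real assume ab: "0 \<le> a" "a < b" "b \<le> 1" "{a<..<b} \<inter> ?D = {}"
    have abI: "a \<in> ?I" "b \<in> ?I" using ab by auto
    obtain k c where kc: "\<And>x. x \<in> {a<..<b} \<Longrightarrow> f x = 2 powi k * x + c"
      using affine_offD[OF affB ab(1-3)] ab(4) by blast
    have "{f a<..<f b} \<inter> C = {}"
    proof (rule ccontr)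
      assume "{f a<..<f b} \<inter> C \<noteq> {}"
      then obtain z where z: "f a < z" "z < f b" "z \<in> C" by auto
      have "z \<in> ?I" using z fI[OF abI(1)] fI[OF abI(2)] by auto
      then obtain x where x: "x \<in> ?I" "z = f x" using im(1) by blast
      have "a < x" "x < b"
        using z x strict_mono_on_less[OF fm] abI by auto
      moreover have "f' z = x" using inv_into_f_f[OF im(2) x(1)] x(2) \<open>z \<in> ?I\<close> by (simp add: f'_def)
      ultimately have "x \<in> {a<..<b} \<inter> ?D" using z(3) \<open>z \<in> ?I\<close> by force
      then show False using ab(4) by blast
    qed
    then obtain l d where ld: "\<And>y. y \<in> {f a<..<f b} \<Longrightarrow> g y = 2 powi l * y + d"
      using affine_offD[OF affC, of "f a" "f b"] fI[OF abI(1)] fI[OF abI(2)] strict_mono_onD[OF fm abI ab(2)] by auto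
    have "compose ?I g f x = 2 powi (l + k) * x + (2 powi l * c + d)" if x: "x \<in> {a<..<b}" for x
    proof -
      have xI: "x \<in> ?I" using x ab by auto
      have "f x \<in> {f a<..<f b}" using strict_mono_onD[OF fm] abI xI x by simp
      then show ?thesis
        using ld kc[OF x] xI by (simp add: compose_eq power_int_add algebra_simps)
    qed
    then show "\<exists>(k :: int) (c :: real). \<forall>x \<in> {a<..<b}. compose ?I g f x = 2 powi k * x + c"
      by blast
  qed
  moreover have "compose ?I g f \<in> Bij ?I" using compose_Bij gB fB by blast
  moreover have "strict_mono_on ?I (compose ?I g f)"
    using fm gm fI by (auto simp: strict_mono_on_def compose_eq)
  moreover have "continuous_on ?I (compose ?I g f)"
  proof -
    have "continuous_on ?I (g \<circ> f)" using continuous_on_compose[OF fc] gc im by simp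
    then show ?thesis by (rule continuous_on_cong[THEN iffD1, rotated -1]) (auto simp: compose_eq)
  qed
  ultimately show ?thesis unfolding carrier_Thompson_F_iff by blast
qed

lemma group_Thompson_F: "group Thompson_F"
proof -
  let ?I = "{0..1} :: real set"
  have "subgroup (carrier Thompson_F) (BijGroup ?I)"
  proof
    show "carrier Thompson_F \<subseteq> carrier (BijGroup ?I)"
      by (auto simp: carrier_Thompson_F_iff BijGroup_def)
    show "x \<otimes>\<^bsub>BijGroup ?I\<^esub> y \<in> carrier Thompson_F"
      if "x \<in> carrier Thompson_F" "y \<in> carrier Thompson_F" for x y
      using that Thompson_F_compose[of y x] by (simp add: BijGroup_def carrier_Thompson_F_iff)
    show "inv\<^bsub>BijGroup ?I\<^esub> x \<in> carrier Thompson_F" if "x \<in> carrier Thompson_F" for x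
      using that Thompson_F_inverse[of x] by (simp add: inv_BijGroup carrier_Thompson_F_iff)
    have "affine_off {} (restrict (\<lambda>x. x) ?I)"
      unfolding affine_off_def
    proof (intro allI impI, elim conjE)
      fix a b :: real assume "0 \<le> a" "b \<le> 1"
      then show "\<exists>(k :: int) (c :: real). \<forall>x \<in> {a<..<b}. restrict (\<lambda>x. x) ?I x = 2 powi k * x + c"
        by (intro exI[of _ 0]) auto
    qed
    moreover have "continuous_on ?I (restrict (\<lambda>x. x) ?I)"
      by (rule continuous_on_eq[of _ "\<lambda>x. x"]) auto
    ultimately have "restrict (\<lambda>x. x) ?I \<in> carrier Thompson_F"
      unfolding carrier_Thompson_F_iff
      by (intro conjI exI[of _ "{}"] id_Bij) (simp_all add: strict_mono_on_def)
    then show "\<one>\<^bsub>BijGroup ?I\<^esub> \<in> carrier Thompson_F" by (simp add: BijGroup_def)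
  qed
  then have "group (BijGroup ?I \<lparr>carrier := carrier Thompson_F\<rparr>)"
    using subgroup.subgroup_is_group group_BijGroup by blast
  then show ?thesis by (simp add: Thompson_F_def)
qed

section \<open>The action of F on the binary words\<close>

text \<open>
  A word describes a path in the tree of standard dyadic intervals, with \<open>False\<close> for the left half
  and \<open>True\<close> for the right half. Its interval has length \<open>1 / 2 ^ length w\<close>, midpoint \<open>centre w\<close> and
  left end point \<open>left_end w\<close>. The midpoints run through the dyadic rationals in \<open>(0, 1)\<close>, each
  once.
\<close>
primrec centre :: "bool list \<Rightarrow> real" where
  "centre [] = 1 / 2"
| "centre (b # w) = (of_bool b + centre w) / 2"

primrec left_end :: "bool list \<Rightarrow> real" where
  "left_end [] = 0"
| "left_end (b # w) = (of_bool b + left_end w) / 2"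

lemma centre_append: "centre (u @ w) = left_end u + centre w / 2 ^ length u"
  by (induction u) (simp_all add: field_simps)

lemma left_end_append: "left_end (u @ w) = left_end u + left_end w / 2 ^ length u"
  by (induction u) (simp_all add: field_simps)

lemma centre_bounds: "0 < centre w" "centre w < 1"
  by (induction w) auto

lemma inj_centre: "inj centre"
proof (rule injI)
  fix v w show "centre v = centre w \<Longrightarrow> v = w"
  proof (induction v arbitrary: w)
    case Nil
    then show ?case
      using centre_bounds[of "tl w"] by (cases w) (auto split: if_splits simp: of_bool_def)
  next
    case (Cons b v)
    show ?case
    proof (cases w)
      case Nil
      then show ?thesis using Cons.prems centre_bounds[of v] by (cases b) auto
    next
      case w: (Cons c w')
      have "b = c" using Cons.prems centre_bounds[of v] centre_bounds[of w'] w
        by (cases b; cases c) auto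
      then show ?thesis using Cons w by simp
    qed
  qed
qed

lemma centre_dyadic: "centre w \<in> dyadics"
proof -
  have "\<exists>m. centre w = real m / 2 ^ Suc (length w)"
  proof (induction w)
    case Nil
    have "centre [] = real 1 / 2 ^ Suc (length [])" by simp
    then show ?case by blast
  next
    case (Cons b w)
    then obtain m where "centre w = real m / 2 ^ Suc (length w)" by blast
    then have "centre (b # w) = real (of_bool b * 2 ^ Suc (length w) + m) / 2 ^ Suc (length (b # w))"
      by (simp add: field_simps)
    then show ?case by blast
  qed
  then show ?thesis unfolding dyadic_iff by blast
qed

lemma centre_surj:
  assumes "x \<in> dyadics" "0 < x" "x < 1"
  shows "\<exists>w. x = centre w"
proof -
  have "\<exists>w. x = centre w" if "x = real m / 2 ^ k" "0 < x" "x < 1" for m k and x :: real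
    using that
  proof (induction k arbitrary: m x)
    case 0 then show ?case by simp
  next
    case (Suc k)
    consider "x = 1 / 2" | "x < 1 / 2" | "1 / 2 < x" by linarith
    then show ?case
    proof cases
      case 1 then have "x = centre []" by simp
      then show ?thesis by blast
    next
      case 2
      have "2 * x = real m / 2 ^ k" using Suc.prems(1) by simp
      then obtain w where "2 * x = centre w" using Suc.IH[of "2 * x" m] Suc.prems 2 by auto
      then have "x = centre (False # w)" by simp
      then show ?thesis by blast
    next
      case 3
      have "2 ^ k < real m" using 3 Suc.prems(1) by (simp add: field_simps)
      then have "2 ^ k \<le> m" by (metis less_imp_le of_nat_le_iff of_nat_numeral of_nat_power)
      then have "2 * x - 1 = real (m - 2 ^ k) / 2 ^ k"
        using Suc.prems(1) by (simp add: of_nat_diff field_simps)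
      then obtain w where "2 * x - 1 = centre w"
        using Suc.IH[of "2 * x - 1" "m - 2 ^ k"] Suc.prems 3 by auto
      then have "x = centre (True # w)" by (simp add: field_simps)
      then show ?thesis by blast
    qed
  qed
  then show ?thesis using assms unfolding dyadic_iff by blast
qed

lemma left_end_grid: "\<exists>j < 2 ^ length u. left_end u = real j / 2 ^ length u"
proof (induction u)
  case (Cons b u)
  then obtain j where j: "j < 2 ^ length u" "left_end u = real j / 2 ^ length u" by blast
  then have "left_end (b # u) = real (of_bool b * 2 ^ length u + j) / 2 ^ length (b # u)"
    by (simp add: field_simps)
  moreover have "of_bool b * 2 ^ length u + j < 2 ^ length (b # u)" using j(1) by (cases b) auto
  ultimately show ?case by blast
qed simp

lemma left_end_surj:
  "j < 2 ^ L \<Longrightarrow> \<exists>v. length v = L \<and> left_end v = real j / 2 ^ L"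
proof (induction L arbitrary: j)
  case (Suc L)
  show ?case
  proof (cases "j < 2 ^ L")
    case True
    then obtain v where "length v = L" "left_end v = real j / 2 ^ L" using Suc.IH by blast
    then have "length (False # v) = Suc L \<and> left_end (False # v) = real j / 2 ^ Suc L" by simp
    then show ?thesis by blast
  next
    case False
    then have "j - 2 ^ L < 2 ^ L" using Suc.prems by simp
    then obtain v where "length v = L" "left_end v = real (j - 2 ^ L) / 2 ^ L" using Suc.IH by blast
    then have "length (True # v) = Suc L \<and> left_end (True # v) = real j / 2 ^ Suc L"
      using False by (simp add: of_nat_diff field_simps)
    then show ?thesis by blast
  qed
qed simp

text \<open>
  \<open>f\<close> maps the dyadic interval of \<open>u\<close> affinely onto that of \<open>v\<close>.
\<close>
definition maps_interval :: "(real \<Rightarrow> real) \<Rightarrow> bool list \<Rightarrow> bool list \<Rightarrow> bool" where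
  "maps_interval f u v \<longleftrightarrow>
     (\<forall>t \<in> {0..1}. f (left_end u + t / 2 ^ length u) = left_end v + t / 2 ^ length v)"

lemma interval_in_unit: "t \<in> {0..1} \<Longrightarrow> left_end u + t / 2 ^ length u \<in> {0..1}"
proof -
  assume t: "t \<in> {0..1}"
  obtain j where j: "j < 2 ^ length u" "left_end u = real j / 2 ^ length u"
    using left_end_grid by blast
  then have "left_end u + t / 2 ^ length u = (real j + t) / 2 ^ length u"
    by (simp add: add_divide_distrib)
  moreover have "real (Suc j) \<le> 2 ^ length u"
    using j(1) by (metis Suc_leI of_nat_le_iff of_nat_numeral of_nat_power)
  ultimately show ?thesis using t by simp
qed

text \<open>
  Let \<open>f\<close> have slope \<open>2 powi k\<close> on a cell and take the value \<open>m / 2 ^ q\<close> at its left end. A dyadic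
  interval of length \<open>1 / 2 ^ l\<close> in the cell has an image of length \<open>1 / 2 ^ L\<close>, \<open>L = l - k\<close>, whose
  left end is \<open>m / 2 ^ q\<close> plus a multiple of this length. If \<open>q \<le> L\<close>, this is a multiple of the
  length as well, so the image is a standard dyadic interval.
\<close>
lemma Thompson_F_maps_intervals_cell:
  assumes f: "f \<in> carrier Thompson_F" and j: "j < 2 ^ N"
    and kc: "\<And>x. x \<in> {real j / 2 ^ N .. real (Suc j) / 2 ^ N} \<Longrightarrow> f x = 2 powi k * x + c"
  shows "\<exists>M. \<forall>u u'. length u = N \<and> left_end u = real j / 2 ^ N \<and> M \<le> length u' \<longrightarrow>
           (\<exists>v. maps_interval f (u @ u') v)"
proof -
  let ?a = "real j / 2 ^ N"
  have fB: "f \<in> Bij {0..1}" using f by (auto simp: carrier_Thompson_F_iff)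
  have "real j \<le> 2 ^ N" using j by (metis less_imp_le of_nat_le_iff of_nat_numeral of_nat_power)
  then have "?a \<in> {0..1}" "?a \<in> dyadics" by (auto simp: dyadic_iff)
  then have "f ?a \<in> dyadics" using Thompson_F_dyadic[OF f] by blast
  then obtain m q where mq: "f ?a = real m / 2 ^ q" unfolding dyadic_iff by blast
  have "\<exists>v. maps_interval f (u @ u') v"
    if u: "length u = N" "left_end u = ?a" and u': "q + nat \<bar>k\<bar> \<le> length u'" for u u'
  proof -
    let ?l = "length (u @ u')"
    (* The image of the interval of u @ u' has length 1 / 2 ^ L. *)
    define L where "L = nat (int ?l - k)"
    have L: "q \<le> L" "int L = int ?l - k" using u' by (simp_all add: L_def)
    have pow: "(2::real) powi k / 2 ^ ?l = 1 / 2 ^ L"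
    proof -
      have "(2::real) powi (int L + k) = 2 powi int ?l" using L(2) by simp
      then have "(2::real) ^ L * 2 powi k = 2 ^ ?l" by (simp add: power_int_add power_add)
      then show ?thesis by (simp add: field_simps)
    qed
    obtain i where i: "i < 2 ^ length u'" "left_end u' = real i / 2 ^ length u'"
      using left_end_grid by blast
    have le: "left_end (u @ u') = ?a + real i / 2 ^ ?l"
      unfolding left_end_append u i by (simp add: power_add u(1))
    have val: "f (left_end (u @ u') + t / 2 ^ ?l) = real (m * 2 ^ (L - q) + i) / 2 ^ L + t / 2 ^ L"
      if t: "t \<in> {0..1}" for t
    proof -
      define s where "s = left_end u' + t / 2 ^ length u'"
      have s: "s \<in> {0..1}" unfolding s_def by (rule interval_in_unit[OF t])
      have x: "left_end (u @ u') + t / 2 ^ ?l = ?a + s / 2 ^ N"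
        unfolding left_end_append u s_def by (simp add: power_add u(1) add_divide_distrib)
      have "?a + s / 2 ^ N \<in> {?a .. real (Suc j) / 2 ^ N}"
        using s by (simp add: add_divide_distrib divide_right_mono)
      then have "f (?a + s / 2 ^ N) = 2 powi k * (?a + s / 2 ^ N) + c" by (rule kc)
      moreover have "f ?a = 2 powi k * ?a + c" by (rule kc) (simp add: divide_right_mono)
      ultimately have "f (?a + s / 2 ^ N) = f ?a + 2 powi k * (s / 2 ^ N)"
        by (simp add: algebra_simps)
      moreover have "s / 2 ^ N = (real i + t) / 2 ^ ?l"
        unfolding s_def i by (simp add: power_add u(1) add_divide_distrib mult.commute)
      then have "2 powi k * (s / 2 ^ N) = (real i + t) * (2 powi k / 2 ^ ?l)" by simp
      then have "2 powi k * (s / 2 ^ N) = (real i + t) / 2 ^ L" unfolding pow by simp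
      moreover have "f ?a = real (m * 2 ^ (L - q)) / 2 ^ L"
      proof -
        have "(2::real) ^ L = 2 ^ (L - q) * 2 ^ q" using L(1) by (simp flip: power_add)
        then show ?thesis unfolding mq by simp
      qed
      ultimately show ?thesis unfolding x by (simp add: add_divide_distrib)
    qed
    have "f (left_end (u @ u') + 1 / 2 ^ ?l) \<in> {0..1}"
      using Bij_imp_funcset[OF fB] interval_in_unit[of 1 "u @ u'"] by (simp add: Pi_iff)
    then have "real (m * 2 ^ (L - q) + i) / 2 ^ L + 1 / 2 ^ L \<le> 1" using val[of 1] by simp
    then have "real (m * 2 ^ (L - q) + i) + 1 \<le> 2 ^ L"
      by (simp add: add_divide_distrib[symmetric] del: of_nat_add of_nat_mult)
    then have "m * 2 ^ (L - q) + i < 2 ^ L"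
      by (metis add.commute less_eq_Suc_le of_nat_Suc of_nat_le_iff of_nat_numeral of_nat_power)
    then obtain v where "length v = L" "left_end v = real (m * 2 ^ (L - q) + i) / 2 ^ L"
      using left_end_surj by blast
    then show ?thesis using val unfolding maps_interval_def by metis
  qed
  then show ?thesis by blast
qed

lemma Thompson_F_maps_intervals:
  assumes f: "f \<in> carrier Thompson_F"
  shows "\<exists>M. \<forall>u. M \<le> length u \<longrightarrow> (\<exists>v. maps_interval f u v)"
proof -
  obtain N where N: "\<And>j. j < 2 ^ N \<Longrightarrow>
      \<exists>k c. \<forall>x \<in> {real j / 2 ^ N .. real (Suc j) / 2 ^ N}. f x = 2 powi k * x + c"
    using Thompson_F_grid[OF f] by blast
  have "\<exists>M. \<forall>u u'. length u = N \<and> left_end u = real j / 2 ^ N \<and> M \<le> length u' \<longrightarrow>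
           (\<exists>v. maps_interval f (u @ u') v)" if "j < 2 ^ N" for j
    using Thompson_F_maps_intervals_cell[OF f that] N[OF that] by meson
  then obtain M where M: "\<And>j u u'. j < 2 ^ N \<Longrightarrow> length u = N \<Longrightarrow> left_end u = real j / 2 ^ N \<Longrightarrow>
      M j \<le> length u' \<Longrightarrow> \<exists>v. maps_interval f (u @ u') v" by metis
  have "\<exists>v. maps_interval f u v" if u: "N + (\<Sum>j < 2 ^ N. M j) \<le> length u" for u
  proof -
    have len: "length (take N u) = N" using u by simp
    then obtain j where j: "j < 2 ^ N" "left_end (take N u) = real j / 2 ^ N"
      using left_end_grid[of "take N u"] by auto
    have "M j \<le> (\<Sum>j < 2 ^ N. M j)" using j(1) by (intro member_le_sum) auto
    then have "M j \<le> length (drop N u)" using u by simp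
    then show ?thesis using M[OF j(1) len j(2), of "drop N u"] by simp
  qed
  then show ?thesis by blast
qed

text \<open>
  The action of \<open>f\<close> on the dyadic rationals in \<open>(0, 1)\<close>, in terms of words.
\<close>
definition induced_tree_map :: "(real \<Rightarrow> real) \<Rightarrow> bool list \<Rightarrow> bool list" where
  "induced_tree_map f w = inv_into UNIV centre (f (centre w))"

lemma centre_induced:
  assumes f: "f \<in> carrier Thompson_F"
  shows "centre (induced_tree_map f w) = f (centre w)"
proof -
  have fB: "f \<in> Bij {0..1}" and mono: "strict_mono_on {0..1} f"
    using f by (auto simp: carrier_Thompson_F_iff)
  have m: "centre w \<in> {0..1}" using centre_bounds[of w] by simp
  have "f 0 < f (centre w)" "f (centre w) < f 1"
    using strict_mono_onD[OF mono] m centre_bounds[of w] by auto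
  then have "f (centre w) \<in> range centre"
    using centre_surj[OF Thompson_F_dyadic[OF f m centre_dyadic]]
      strict_mono_bij_unit_interval[OF fB mono] by auto
  then show ?thesis unfolding induced_tree_map_def by (rule f_inv_into_f)
qed

lemma induced_tree_map_eqI:
  assumes "f \<in> carrier Thompson_F" "f (centre w) = centre v"
  shows "induced_tree_map f w = v"
  using centre_induced[OF assms(1), of w] assms(2) inj_centre by (simp add: inj_eq)

lemma induced_tree_map_compose:
  assumes f: "f \<in> carrier Thompson_F" and g: "g \<in> carrier Thompson_F"
  shows "induced_tree_map (compose {0..1} g f) = induced_tree_map g \<circ> induced_tree_map f"
proof
  fix w
  have "compose {0..1} g f (centre w) = g (f (centre w))"
    using centre_bounds[of w] by (simp add: compose_eq)
  then show "induced_tree_map (compose {0..1} g f) w = (induced_tree_map g \<circ> induced_tree_map f) w"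
    using centre_induced[OF f] centre_induced[OF g]
    by (intro induced_tree_map_eqI Thompson_F_compose f g) simp
qed

lemma induced_tree_map_bij:
  assumes f: "f \<in> carrier Thompson_F"
  shows "bij (induced_tree_map f)"
proof -
  define g where "g = restrict (inv_into {0..1} f) {0..1}"
  have g: "g \<in> carrier Thompson_F" unfolding g_def by (rule Thompson_F_inverse[OF f])
  have im: "f ` {0..1} = {0..1}" "inj_on f {0..1}"
    using f by (auto simp: carrier_Thompson_F_iff Bij_def bij_betw_def)
  have I: "centre w \<in> {0..1}" for w using centre_bounds[of w] by simp
  have "f (centre w) \<in> {0..1}" for w using I im(1) by blast
  then have gf: "g (f (centre w)) = centre w" for w
    using inv_into_f_f[OF im(2) I] unfolding g_def by (simp del: atLeastAtMost_iff)
  have fg: "f (g (centre w)) = centre w" for w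
    using f_inv_into_f[of "centre w" f "{0..1}"] I im(1) unfolding g_def
    by (simp del: atLeastAtMost_iff)
  show ?thesis
  proof (rule o_bij)
    show "induced_tree_map g \<circ> induced_tree_map f = id"
      using gf centre_induced[OF f] by (auto simp: fun_eq_iff intro: induced_tree_map_eqI[OF g])
    show "induced_tree_map f \<circ> induced_tree_map g = id"
      using fg centre_induced[OF g] by (auto simp: fun_eq_iff intro: induced_tree_map_eqI[OF f])
  qed
qed

text \<open>
  The midpoint for \<open>u w\<close> has the same relative position in the interval of \<open>u\<close> as that for
  \<open>v w\<close> has in the interval of \<open>v\<close>.
\<close>
lemma maps_interval_induced:
  assumes f: "f \<in> carrier Thompson_F" and uv: "maps_interval f u v"
  shows "induced_tree_map f (u @ w) = v @ w"
  using uv centre_bounds[of w] unfolding maps_interval_def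
  by (intro induced_tree_map_eqI[OF f]) (simp add: centre_append)

lemma induced_tree_map_in_tree_maps:
  assumes f: "f \<in> carrier Thompson_F"
  shows "induced_tree_map f \<in> tree_maps"
proof -
  obtain M where M: "\<And>u. M \<le> length u \<Longrightarrow> \<exists>v. maps_interval f u v"
    using Thompson_F_maps_intervals[OF f] by blast
  have "rigid (induced_tree_map f) u" if "M \<le> length u" for u
  proof -
    obtain v where v: "maps_interval f u v" using M \<open>M \<le> length u\<close> by blast
    show ?thesis
      unfolding rigid_def using maps_interval_induced[OF f v] by (metis append_Nil2)
  qed
  then show ?thesis using induced_tree_map_bij[OF f] by (auto simp: tree_maps_def)
qed

text \<open>
  The induced map at the words of a large length determines to which interval each of
  the corresponding dyadic intervals is mapped. These intervals cover the unit interval.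
\<close>
lemma induced_tree_map_inj:
  assumes f: "f \<in> carrier Thompson_F" and g: "g \<in> carrier Thompson_F"
    and eq: "induced_tree_map f = induced_tree_map g"
  shows "f = g"
proof (rule extensionalityI)
  show "f \<in> extensional {0..1}" "g \<in> extensional {0..1}"
    using f g by (auto simp: carrier_Thompson_F_iff Bij_imp_extensional)
  obtain M M' where M: "\<And>u. M \<le> length u \<Longrightarrow> \<exists>v. maps_interval f u v"
    and M': "\<And>u. M' \<le> length u \<Longrightarrow> \<exists>v. maps_interval g u v"
    using Thompson_F_maps_intervals[OF f] Thompson_F_maps_intervals[OF g] by blast
  fix x :: real assume x: "x \<in> {0..1}"
  let ?L = "max M M'"
  obtain j where j: "j < 2 ^ ?L" "x \<in> {real j / 2 ^ ?L .. real (Suc j) / 2 ^ ?L}"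
    using grid_cell[OF x] by blast
  obtain u where u: "length u = ?L" "left_end u = real j / 2 ^ ?L"
    using left_end_surj[OF j(1)] by blast
  define t where "t = x * 2 ^ ?L - real j"
  have t: "t \<in> {0..1}" using j(2) by (simp add: t_def field_simps)
  have xt: "x = left_end u + t / 2 ^ length u" unfolding u t_def by (simp add: field_simps)
  obtain v v' where v: "maps_interval f u v" and v': "maps_interval g u v'"
    using M M' u(1) by (metis max.cobounded1 max.cobounded2)
  have "v = v'"
    using maps_interval_induced[OF f v, of "[]"] maps_interval_induced[OF g v', of "[]"] eq by simp
  then show "f x = g x" using v v' t unfolding xt maps_interval_def by simp
qed

section \<open>Higman--Thompson groups as groups of local prefix replacements\<close>

lemma cantor_iff [simp]: "(i, x) \<in> cantor n r \<longleftrightarrow> i \<in> {1..r} \<and> x \<in> infinite_words n"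
  by (simp add: cantor_def)

lemma subword_in_lists [simp]:
  "x \<in> infinite_words n \<Longrightarrow> x [k \<rightarrow> m] \<in> lists {..<n}"
  "x \<in> infinite_words n \<Longrightarrow> suffix m x \<in> infinite_words n"
  by (auto simp: infinite_words_def in_lists_conv_set)

lemma infinite_word_exists:
  assumes "1 \<le> n" obtains y where "y \<in> infinite_words n"
proof
  show "(\<lambda>_. 0) \<in> infinite_words n" using assms by (auto simp: infinite_words_def)
qed

definition replaces :: "nat \<Rightarrow> (nat \<times> nat word \<Rightarrow> nat \<times> nat word) \<Rightarrow> nat \<times> nat list \<Rightarrow> nat \<times> nat list \<Rightarrow> bool" where
  "replaces n g a b \<longleftrightarrow> (\<forall>y \<in> infinite_words n. g (fst a, snd a \<frown> y) = (fst b, snd b \<frown> y))"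

lemma replacesD:
  "replaces n g (i, p) (j, v) \<Longrightarrow> y \<in> infinite_words n \<Longrightarrow> g (i, p \<frown> y) = (j, v \<frown> y)"
  by (simp add: replaces_def)

lemma replaces_extend:
  assumes "replaces n g (i, p) (j, v)" "w \<in> lists {..<n}"
  shows "replaces n g (i, p @ w) (j, v @ w)"
  unfolding replaces_def
proof
  fix y assume "y \<in> infinite_words n"
  then have "g (i, p \<frown> w \<frown> y) = (j, v \<frown> w \<frown> y)"
    using assms(2) by (intro replacesD[OF assms(1)]) simp
  then show "g (fst (i, p @ w), snd (i, p @ w) \<frown> y) = (fst (j, v @ w), snd (j, v @ w) \<frown> y)"
    by simp
qed

text \<open>
  The local form of the condition that defines the Higman--Thompson group: near each point the map
  replaces one prefix by another.
\<close>
definition prefix_replacing :: "nat \<Rightarrow> nat \<Rightarrow> (nat \<times> nat word \<Rightarrow> nat \<times> nat word) \<Rightarrow> bool" where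
  "prefix_replacing n r g \<longleftrightarrow>
     (\<forall>i \<in> {1..r}. \<forall>x \<in> infinite_words n. \<exists>m b. replaces n g (i, prefix m x) b)"

text \<open>
  A prefix replacement restricts to all smaller cones.
\<close>
lemma prefix_replacing_at_depth:
  assumes "prefix_replacing n r g" "(i, x) \<in> cantor n r"
  shows "\<exists>m j v. M \<le> m \<and> replaces n g (i, prefix m x) (j, v)"
proof -
  have x: "i \<in> {1..r}" "x \<in> infinite_words n" using assms(2) by auto
  then obtain m b where "replaces n g (i, prefix m x) b"
    using assms(1) unfolding prefix_replacing_def by blast
  then have "replaces n g (i, prefix m x) (fst b, snd b)" by simp
  then have "replaces n g (i, prefix m x @ prefix M (suffix m x)) (fst b, snd b @ prefix M (suffix m x))"
    by (rule replaces_extend) (use x in simp)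
  moreover have "prefix m x @ prefix M (suffix m x) = prefix (m + M) x"
    by (simp add: subsequence_append)
  ultimately have "M \<le> m + M \<and> replaces n g (i, prefix (m + M) x) (fst b, snd b @ prefix M (suffix m x))"
    by simp
  then show ?thesis by blast
qed

text \<open>
  Koenig's lemma: if the property failed for arbitrarily long words, then some infinite word would
  have no prefix with the property.
\<close>
lemma eventual_prefix_property_uniform:
  assumes ext: "\<And>p w. p \<in> lists {..<n} \<Longrightarrow> w \<in> lists {..<n} \<Longrightarrow> G p \<Longrightarrow> G (p @ w)"
    and pt: "\<And>x. x \<in> infinite_words n \<Longrightarrow> \<exists>m. G (prefix m x)"
  shows "\<exists>N. \<forall>p \<in> lists {..<n}. N \<le> length p \<longrightarrow> G p"
proof (rule ccontr)
  (* A word is bad if it has arbitrarily long extensions without the property. *)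
  define bad where "bad p \<longleftrightarrow> p \<in> lists {..<n} \<and>
    (\<forall>N. \<exists>w \<in> lists {..<n}. N \<le> length w \<and> \<not> G (p @ w))" for p
  assume "\<not> ?thesis"
  then have bad0: "bad []" unfolding bad_def by simp
  have step: "\<exists>a. a < n \<and> bad (p @ [a])" if p: "bad p" for p
  proof (rule ccontr)
    assume "\<nexists>a. a < n \<and> bad (p @ [a])"
    then have "\<forall>a \<in> {..<n}. \<exists>N. \<forall>w \<in> lists {..<n}. N \<le> length w \<longrightarrow> G ((p @ [a]) @ w)"
      using p unfolding bad_def by auto
    then obtain N where N: "\<And>a w. a < n \<Longrightarrow> w \<in> lists {..<n} \<Longrightarrow> N a \<le> length w \<Longrightarrow> G (p @ a # w)"
      by (subst (asm) bchoice_iff) auto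
    obtain w where w: "w \<in> lists {..<n}" "Suc (\<Sum>a<n. N a) \<le> length w" "\<not> G (p @ w)"
      using p unfolding bad_def by blast
    then obtain a w' where w': "w = a # w'" by (cases w) auto
    then have a: "a < n" "w' \<in> lists {..<n}" using w(1) by auto
    have "N a \<le> (\<Sum>a<n. N a)" using a by (intro member_le_sum) auto
    then have "G (p @ w)" using N[OF a] w(2) w' by simp
    with w(3) show False by blast
  qed
  define nxt where "nxt p = (SOME a. a < n \<and> bad (p @ [a]))" for p
  have next_bad: "nxt p < n \<and> bad (p @ [nxt p])" if "bad p" for p
    unfolding nxt_def by (rule someI_ex) (rule step[OF that])
  define f where "f = rec_nat [] (\<lambda>_ p. p @ [nxt p])"
  have f: "f 0 = []" "f (Suc k) = f k @ [nxt (f k)]" for k by (simp_all add: f_def)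
  have fbad: "bad (f k)" for k by (induction k) (use bad0 next_bad f in auto)
  define x where "x k = nxt (f k)" for k
  have pre: "prefix k x = f k" for k by (induction k) (auto simp: f x_def)
  have "x \<in> infinite_words n" using next_bad fbad by (auto simp: infinite_words_def x_def)
  then obtain m where m: "G (f m)" using pt pre by metis
  obtain w where "w \<in> lists {..<n}" "\<not> G (f m @ w)" using fbad[of m] unfolding bad_def by blast
  moreover have "f m \<in> lists {..<n}" using fbad[of m] unfolding bad_def by blast
  ultimately show False using ext m by blast
qed

lemma prefix_replacing_uniform:
  assumes "prefix_replacing n r g"
  shows "\<exists>N. \<forall>i \<in> {1..r}. \<forall>p \<in> lists {..<n}. N \<le> length p \<longrightarrow> (\<exists>b. replaces n g (i, p) b)"
proof -
  have "\<exists>N. \<forall>p \<in> lists {..<n}. N \<le> length p \<longrightarrow> (\<exists>b. replaces n g (i, p) b)" if i: "i \<in> {1..r}" for i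
  proof (rule eventual_prefix_property_uniform)
    show "\<exists>b. replaces n g (i, p @ w) b" if "w \<in> lists {..<n}" "\<exists>b. replaces n g (i, p) b" for p w
      using that replaces_extend by (metis surj_pair)
    show "\<exists>m b. replaces n g (i, prefix m x) b" if "x \<in> infinite_words n" for x
      using assms i that unfolding prefix_replacing_def by blast
  qed
  then have "\<forall>i \<in> {1..r}. \<exists>N. \<forall>p \<in> lists {..<n}. N \<le> length p \<longrightarrow> (\<exists>b. replaces n g (i, p) b)"
    by blast
  from bchoice[OF this] obtain N where
    N: "\<forall>i \<in> {1..r}. \<forall>p \<in> lists {..<n}. N i \<le> length p \<longrightarrow> (\<exists>b. replaces n g (i, p) b)" ..
  have "N i \<le> (\<Sum>i \<in> {1..r}. N i)" if "i \<in> {1..r}" for i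
    using that by (intro member_le_sum) auto
  then show ?thesis using N le_trans by blast
qed

text \<open>
  The cones form a base of the topology.
\<close>
lemma openin_cantor_topology:
  "openin (cantor_topology n r) U \<longleftrightarrow>
     U \<subseteq> cantor n r \<and> (\<forall>i x. (i, x) \<in> U \<longrightarrow> (\<exists>m. cone n (i, prefix m x) \<subseteq> U))"
proof
  assume U: "openin (cantor_topology n r) U"
  have "\<exists>m. cone n (i, prefix m x) \<subseteq> U" if ix: "(i, x) \<in> U" for i x
  proof -
    obtain A V where AV: "i \<in> A" "openin (product_topology (\<lambda>_. discrete_topology {..<n}) UNIV) V"
        "x \<in> V" "A \<times> V \<subseteq> U"
      using U ix unfolding cantor_topology_def openin_prod_topology_alt by meson
    from bspec[OF AV(2)[unfolded openin_product_topology_alt] AV(3)]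
    obtain D where "finite {k \<in> UNIV. D k \<noteq> topspace (discrete_topology {..<n})}"
      and D': "x \<in> Pi\<^sub>E UNIV D" "Pi\<^sub>E UNIV D \<subseteq> V" by meson
    then have D: "finite {k :: nat. D k \<noteq> {..<n}}" by simp
    obtain m where m: "\<And>k. D k \<noteq> {..<n} \<Longrightarrow> k < m"
      using D finite_nat_set_iff_bounded[of "{k. D k \<noteq> {..<n}}"] by auto
    have "prefix m x \<frown> y \<in> V" if y: "y \<in> infinite_words n" for y
    proof -
      have "(prefix m x \<frown> y) k \<in> D k" for k
      proof (cases "k < m")
        case True then show ?thesis using PiE_mem[OF D'(1)] by simp
      next
        case False
        then have "D k = {..<n}" using m by blast
        then show ?thesis using False y by (auto simp: infinite_words_def)
      qed
      then have "prefix m x \<frown> y \<in> Pi\<^sub>E UNIV D" by (simp add: PiE_UNIV_domain)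
      then show ?thesis using D'(2) by blast
    qed
    then have "cone n (i, prefix m x) \<subseteq> U" using AV by (auto simp: cone_def)
    then show ?thesis by blast
  qed
  moreover have "U \<subseteq> cantor n r" using openin_subset[OF U] by (simp add: topspace_cantor_topology)
  ultimately show "U \<subseteq> cantor n r \<and> (\<forall>i x. (i, x) \<in> U \<longrightarrow> (\<exists>m. cone n (i, prefix m x) \<subseteq> U))" by blast
next
  assume U: "U \<subseteq> cantor n r \<and> (\<forall>i x. (i, x) \<in> U \<longrightarrow> (\<exists>m. cone n (i, prefix m x) \<subseteq> U))"
  show "openin (cantor_topology n r) U"
    unfolding cantor_topology_def openin_prod_topology_alt
  proof (intro allI impI)
    fix i x assume ix: "(i, x) \<in> U"
    then have c: "i \<in> {1..r}" "x \<in> infinite_words n" using U cantor_iff by blast+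
    obtain m where m: "cone n (i, prefix m x) \<subseteq> U" using U ix by blast
    define D where "D k = (if k < m then {x k} else {..<n})" for k
    have xn: "x k < n" for k using c(2) by (auto simp: infinite_words_def)
    have "{k \<in> UNIV. D k \<noteq> topspace (discrete_topology {..<n})} \<subseteq> {..<m}" by (auto simp: D_def)
    then have fin: "finite {k \<in> UNIV. D k \<noteq> topspace (discrete_topology {..<n})}"
      using finite_lessThan finite_subset by blast
    have "openin (product_topology (\<lambda>_. discrete_topology {..<n}) UNIV) (Pi\<^sub>E UNIV D)"
      unfolding openin_product_topology_alt
    proof (intro ballI exI[of _ D] conjI)
      show "openin (discrete_topology {..<n}) (D k)" for k using xn by (auto simp: D_def)
    qed (use fin in auto)
    moreover have "x \<in> Pi\<^sub>E UNIV D" using xn by (auto simp: D_def)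
    moreover have "{i} \<times> Pi\<^sub>E UNIV D \<subseteq> U"
    proof -
      have "(i, y) \<in> U" if y: "y \<in> Pi\<^sub>E UNIV D" for y
      proof -
        have yD: "y k \<in> D k" for k using y by auto
        have "y k = x k" if "k < m" for k using yD[of k] that by (simp add: D_def)
        then have "prefix m y = prefix m x" by (simp add: subsequence_def)
        moreover have "y k < n" for k using yD[of k] xn[of k] by (auto simp: D_def split: if_splits)
        then have "y \<in> infinite_words n" by (auto simp: infinite_words_def)
        moreover have "y = prefix m y \<frown> suffix m y" by simp
        ultimately have "\<exists>z \<in> infinite_words n. y = prefix m x \<frown> z"
          using subword_in_lists(2) by metis
        then have "(i, y) \<in> cone n (i, prefix m x)" by (auto simp: cone_def)
        then show ?thesis using m by blast
      qed
      then show ?thesis by auto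
    qed
    ultimately show "\<exists>A V. openin (discrete_topology {1..r}) A \<and>
        openin (product_topology (\<lambda>_. discrete_topology {..<n}) UNIV) V \<and> i \<in> A \<and> x \<in> V \<and> A \<times> V \<subseteq> U"
      using c(1) by (intro exI[of _ "{i}"] exI[of _ "Pi\<^sub>E UNIV D"]) auto
  qed
qed

lemma in_cone_prefix: "x \<in> infinite_words n \<Longrightarrow> (i, x) \<in> cone n (i, prefix m x)"
proof -
  assume "x \<in> infinite_words n"
  then have "x = prefix m x \<frown> suffix m x" "suffix m x \<in> infinite_words n" by simp_all
  then show ?thesis unfolding cone_def by blast
qed

lemma prefix_replacing_continuous:
  assumes g: "g \<in> cantor n r \<rightarrow> cantor n r" and pr: "prefix_replacing n r g"
  shows "continuous_map (cantor_topology n r) (cantor_topology n r) g"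
  unfolding continuous_map_def topspace_cantor_topology
proof (intro conjI allI impI g)
  fix U assume U: "openin (cantor_topology n r) U"
  show "openin (cantor_topology n r) {c \<in> cantor n r. g c \<in> U}"
    unfolding openin_cantor_topology
  proof (intro conjI allI impI)
    fix i x assume "(i, x) \<in> {c \<in> cantor n r. g c \<in> U}"
    then have ix: "i \<in> {1..r}" "x \<in> infinite_words n" "g (i, x) \<in> U" by auto
    then obtain m j v where rep: "replaces n g (i, prefix m x) (j, v)"
      using prefix_replacing_at_depth[OF pr, of i x] cantor_iff by blast
    have gx: "g (i, x) = (j, v \<frown> suffix m x)"
      using replacesD[OF rep, of "suffix m x"] ix by simp
    obtain k where k: "cone n (j, prefix k (v \<frown> suffix m x)) \<subseteq> U"
      using U ix(3) unfolding gx openin_cantor_topology by blast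
    have "cone n (i, prefix (m + k) x) \<subseteq> {c \<in> cantor n r. g c \<in> U}"
    proof -
      have "g (i, prefix (m + k) x \<frown> y) \<in> U" if y: "y \<in> infinite_words n" for y
      proof -
        define y' where "y' = prefix k (suffix m x) \<frown> y"
        have y': "y' \<in> infinite_words n" using y ix by (simp add: y'_def)
        have "prefix (m + k) x \<frown> y = prefix m x \<frown> y'"
          by (simp add: y'_def subsequence_append)
        then have "g (i, prefix (m + k) x \<frown> y) = (j, v \<frown> y')" using replacesD[OF rep y'] by simp
        moreover have agree: "y' l = suffix m x l" if "l < k" for l
          using that by (simp add: y'_def)
        have "prefix k (v \<frown> y') = prefix k (v \<frown> suffix m x)"
        proof (rule nth_equalityI)
          fix l assume "l < length (prefix k (v \<frown> y'))"
          then have "l < k" by simp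
          then have "(v \<frown> y') l = (v \<frown> suffix m x) l"
            using agree[of "l - length v"] by (cases "l < length v") simp_all
          then show "prefix k (v \<frown> y') ! l = prefix k (v \<frown> suffix m x) ! l"
            using \<open>l < k\<close> by (simp only: subsequence_nth diff_zero add_0)
        qed simp
        moreover have "v \<frown> y' \<in> infinite_words n"
        proof -
          have "(i, x) \<in> cantor n r" "(i, prefix m x \<frown> y') \<in> cantor n r" using ix y' by simp_all
          then have "(j, v \<frown> y') \<in> cantor n r" using g replacesD[OF rep y'] by (metis Pi_mem)
          then show ?thesis by simp
        qed
        then have "(j, v \<frown> y') \<in> cone n (j, prefix k (v \<frown> y'))"
          by (rule in_cone_prefix)
        ultimately show ?thesis using k by auto
      qed
      then show ?thesis using ix by (auto simp: cone_def)
    qed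
    then show "\<exists>m. cone n (i, prefix m x) \<subseteq> {c \<in> cantor n r. g c \<in> U}" by blast
  qed auto
qed

lemma prefix_replacing_cong:
  assumes "\<And>c. c \<in> cantor n r \<Longrightarrow> f c = g c" "prefix_replacing n r f"
  shows "prefix_replacing n r g"
  unfolding prefix_replacing_def
proof (intro ballI)
  fix i x assume ix: "i \<in> {1..r}" "x \<in> infinite_words n"
  then obtain m b where "replaces n f (i, prefix m x) b"
    using assms(2) unfolding prefix_replacing_def by blast
  then have "replaces n g (i, prefix m x) b"
    using assms(1) ix unfolding replaces_def by simp
  then show "\<exists>m b. replaces n g (i, prefix m x) b" by blast
qed

lemma prefix_replacing_comp:
  assumes f: "f \<in> cantor n r \<rightarrow> cantor n r" "prefix_replacing n r f" and g: "prefix_replacing n r g"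
  shows "prefix_replacing n r (g \<circ> f)"
  unfolding prefix_replacing_def
proof (intro ballI)
  fix i x assume ix: "i \<in> {1..r}" "x \<in> infinite_words n"
  then obtain m j v where rep: "replaces n f (i, prefix m x) (j, v)"
    using prefix_replacing_at_depth[OF f(2), of i x] cantor_iff by blast
  have fx: "f (i, x) = (j, v \<frown> suffix m x)" using replacesD[OF rep, of "suffix m x"] ix by simp
  then have "(j, v \<frown> suffix m x) \<in> cantor n r" using f(1) ix by (metis Pi_mem cantor_iff)
  then obtain k j' v' where k: "length v \<le> k" "replaces n g (j, prefix k (v \<frown> suffix m x)) (j', v')"
    using prefix_replacing_at_depth[OF g] by blast
  have w: "prefix (k - length v) (suffix m x) \<in> lists {..<n}" using ix by simp
  have "prefix k (v \<frown> suffix m x) = v @ prefix (k - length v) (suffix m x)"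
    by (rule prefix_conc_snd[OF k(1)])
  moreover have "prefix (m + (k - length v)) x = prefix m x @ prefix (k - length v) (suffix m x)"
    by (simp add: subsequence_append)
  ultimately have "replaces n (g \<circ> f) (i, prefix (m + (k - length v)) x) (j', v')"
    using replaces_extend[OF rep w] k(2) by (simp add: replaces_def)
  then show "\<exists>m b. replaces n (g \<circ> f) (i, prefix m x) b" by blast
qed

lemma prefix_replacing_inverse:
  assumes inv: "\<And>c. c \<in> cantor n r \<Longrightarrow> g (f c) = c"
      "\<And>c. c \<in> cantor n r \<Longrightarrow> g c \<in> cantor n r \<and> f (g c) = c"
    and pr: "prefix_replacing n r f"
  shows "prefix_replacing n r g"
  unfolding prefix_replacing_def
proof (intro ballI)
  fix j x' assume jx: "j \<in> {1..r}" "x' \<in> infinite_words n"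
  obtain i x where ix: "g (j, x') = (i, x)" by (cases "g (j, x')") auto
  then have c: "(i, x) \<in> cantor n r" "f (i, x) = (j, x')" using inv(2)[of "(j, x')"] jx by auto
  obtain m j' v where rep: "replaces n f (i, prefix m x) (j', v)"
    using prefix_replacing_at_depth[OF pr c(1)] by blast
  have "f (i, x) = (j', v \<frown> suffix m x)" using replacesD[OF rep, of "suffix m x"] c(1) by simp
  then have jv: "j' = j" "x' = v \<frown> suffix m x" using c(2) by auto
  have "replaces n g (j, prefix (length v) x') (i, prefix m x)"
    unfolding replaces_def
  proof
    fix y assume y: "y \<in> infinite_words n"
    have "g (f (i, prefix m x \<frown> y)) = (i, prefix m x \<frown> y)" using c(1) y by (intro inv(1)) simp
    then show "g (fst (j, prefix (length v) x'), snd (j, prefix (length v) x') \<frown> y) =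
        (fst (i, prefix m x), snd (i, prefix m x) \<frown> y)"
      using replacesD[OF rep y] jv by simp
  qed
  then show "\<exists>m b. replaces n g (j, prefix m x') b" by blast
qed

lemma BijD:
  assumes "f \<in> Bij S"
  shows "f \<in> S \<rightarrow> S" "\<And>x. x \<in> S \<Longrightarrow> f x \<in> S" "\<And>x. x \<in> S \<Longrightarrow> inv_into S f (f x) = x"
    "\<And>x. x \<in> S \<Longrightarrow> inv_into S f x \<in> S" "\<And>x. x \<in> S \<Longrightarrow> f (inv_into S f x) = x"
    "f ` S = S" "inj_on f S"
  using assms by (auto simp: Bij_def bij_betw_def f_inv_into_f inv_into_into)

lemma prefix_replacing_inv_into:
  assumes g: "g \<in> Bij (cantor n r)" "prefix_replacing n r g"
  shows "prefix_replacing n r (inv_into (cantor n r) g)"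
  by (rule prefix_replacing_inverse[OF _ _ g(2)]) (use BijD[OF g(1)] in auto)

lemma prefix_replacing_homeomorphic:
  assumes g: "g \<in> Bij (cantor n r)" "prefix_replacing n r g"
  shows "homeomorphic_map (cantor_topology n r) (cantor_topology n r) g"
proof -
  have "homeomorphic_maps (cantor_topology n r) (cantor_topology n r) g (inv_into (cantor n r) g)"
    unfolding homeomorphic_maps_def topspace_cantor_topology
    using BijD[OF g(1)] g prefix_replacing_continuous prefix_replacing_inv_into by auto
  then show ?thesis using homeomorphic_map_maps by blast
qed

lemma replaces_cone:
  assumes "replaces n g a b" shows "g ` cone n a = cone n b"
  using assms by (cases a; cases b) (force simp: cone_def replaces_def image_iff)

lemma cone_partition_of_depth:
  assumes n: "1 \<le> n" and ps: "set ps = {1..r} \<times> {p \<in> lists {..<n}. length p = N}" "distinct ps"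
  shows "cone_partition n r ps"
proof -
  obtain y where y: "y \<in> infinite_words n" using infinite_word_exists[OF n] .
  have disj: "a = b" if ab: "a \<in> set ps" "b \<in> set ps" "c \<in> cone n a" "c \<in> cone n b" for a b c
  proof -
    obtain i p i' p' where "a = (i, p)" "b = (i', p')" by (cases a; cases b) blast
    moreover from this have "length p = length p'" using ab(1,2) unfolding ps by simp
    ultimately show ?thesis using ab(3,4) by (auto simp: cone_def)
  qed
  have ne: "(fst a, snd a \<frown> y) \<in> cone n a" for a using y by (auto simp: cone_def split: prod.splits)
  have "inj_on (cone n) (set ps)" by (rule inj_onI) (use disj ne in metis)
  then have "distinct (map (cone n) ps)" using ps(2) by (simp add: distinct_map)
  moreover have "partition_on (cantor n r) (cone n ` set ps)"
  proof (rule partition_onI)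
    show "\<Union> (cone n ` set ps) = cantor n r"
    proof (intro subset_antisym subsetI)
      fix c assume "c \<in> \<Union> (cone n ` set ps)"
      then show "c \<in> cantor n r" unfolding ps by (auto simp: cone_def cantor_def)
    next
      fix c assume c: "c \<in> cantor n r"
      obtain i x where ix: "c = (i, x)" by (cases c)
      have "(i, prefix N x) \<in> set ps" using c ix unfolding ps by simp
      moreover have "c \<in> cone n (i, prefix N x)" using c unfolding ix by (intro in_cone_prefix) simp
      ultimately show "c \<in> \<Union> (cone n ` set ps)" by blast
    qed
    show "disjnt A B" if "A \<in> cone n ` set ps" "B \<in> cone n ` set ps" "A \<noteq> B" for A B
      using that disj unfolding disjnt_def by blast
    show "{} \<notin> cone n ` set ps" using ne by blast
  qed
  ultimately show ?thesis unfolding cone_partition_def using ps(1) by auto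
qed

text \<open>
  A partition into cones gives a prefix replacement near every point. Conversely, by compactness
  the prefixes of one common length \<open>N\<close> can be replaced. Their cones partition the
  space, and as the map is bijective, so do the images of these cones.
\<close>
theorem Higman_Thompson_carrier:
  assumes n: "1 \<le> n"
  shows "carrier (Higman_Thompson n r) = {g \<in> Bij (cantor n r). prefix_replacing n r g}"
proof (intro subset_antisym subsetI)
  fix g assume "g \<in> carrier (Higman_Thompson n r)"
  then obtain ps qs where g: "g \<in> Bij (cantor n r)" and ps: "cone_partition n r ps"
    and rep: "\<And>s x. s < length ps \<Longrightarrow> x \<in> infinite_words n \<Longrightarrow>
      g (fst (ps ! s), snd (ps ! s) \<frown> x) = (fst (qs ! s), snd (qs ! s) \<frown> x)"
    unfolding Higman_Thompson_def by auto
  have "prefix_replacing n r g"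
    unfolding prefix_replacing_def
  proof (intro ballI)
    fix i x assume ix: "i \<in> {1..r}" "x \<in> infinite_words n"
    then have "(i, x) \<in> \<Union> (cone n ` set ps)"
      using ps unfolding cone_partition_def partition_on_def by simp
    then obtain a where a: "a \<in> set ps" "(i, x) \<in> cone n a" by blast
    then obtain s where s: "s < length ps" "ps ! s = a" by (auto simp: in_set_conv_nth)
    have ia: "i = fst a" "\<exists>z. x = snd a \<frown> z" using a(2) by (auto simp: cone_def split: prod.splits)
    then have "a = (i, prefix (length (snd a)) x)" by (cases a) auto
    then have "replaces n g (i, prefix (length (snd a)) x) (qs ! s)"
      using rep[OF s(1)] s(2) unfolding replaces_def by simp
    then show "\<exists>m b. replaces n g (i, prefix m x) b" by blast
  qed
  with g show "g \<in> {g \<in> Bij (cantor n r). prefix_replacing n r g}" by blast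
next
  fix g assume "g \<in> {g \<in> Bij (cantor n r). prefix_replacing n r g}"
  then have g: "g \<in> Bij (cantor n r)" "prefix_replacing n r g" by auto
  let ?C = "cantor n r"
  obtain y where y: "y \<in> infinite_words n" using infinite_word_exists[OF n] .
  obtain N where N: "\<And>i p. i \<in> {1..r} \<Longrightarrow> p \<in> lists {..<n} \<Longrightarrow> N \<le> length p \<Longrightarrow> \<exists>b. replaces n g (i, p) b"
    using prefix_replacing_uniform[OF g(2)] by blast
  let ?S = "{1..r} \<times> {p \<in> lists {..<n}. length p = N}"
  have "finite ?S"
    using finite_lists_length_eq[of "{..<n}" N] by (auto simp: lists_eq_set)
  from finite_distinct_list[OF this] obtain ps where "set ps = ?S \<and> distinct ps" ..
  then have ps: "set ps = ?S" "distinct ps" by simp_all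
  have "\<forall>a \<in> ?S. \<exists>b. replaces n g a b" using N by auto
  from bchoice[OF this] obtain q where "\<forall>a \<in> ?S. replaces n g a (q a)" ..
  then have q: "\<And>a. a \<in> ?S \<Longrightarrow> replaces n g a (q a)" by blast
  let ?qs = "map q ps"
  have part: "cone_partition n r ps" by (rule cone_partition_of_depth[OF n ps])
  have im: "cone n (q a) = g ` cone n a" if "a \<in> set ps" for a
    using replaces_cone q that ps(1) by metis
  have qin: "q a \<in> {1..r} \<times> lists {..<n}" if a: "a \<in> set ps" for a
  proof -
    have "(fst a, snd a \<frown> y) \<in> ?C" using a y unfolding ps by auto
    then have "g (fst a, snd a \<frown> y) \<in> ?C" by (rule BijD(2)[OF g(1)])
    moreover have "g (fst a, snd a \<frown> y) = (fst (q a), snd (q a) \<frown> y)"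
      using q a y unfolding ps replaces_def by blast
    ultimately show ?thesis by (cases "q a") auto
  qed
  have sub: "cone n a \<subseteq> ?C" if "a \<in> set ps" for a
    using part that unfolding cone_partition_def partition_on_def by blast
  have imgs: "cone n ` set ?qs = (`) g ` cone n ` set ps" using im by (force simp: image_iff)
  have "inj_on (cone n) (set ps)" using part by (simp add: cone_partition_def distinct_map)
  then have "inj_on (cone n \<circ> q) (set ps)"
    using im sub inj_on_image_eq_iff[OF BijD(7)[OF g(1)]] unfolding inj_on_def by simp
  then have dist: "distinct (map (cone n) ?qs)" using ps(2) by (simp add: distinct_map)
  have "partition_on (g ` ?C) ((`) g ` cone n ` set ps - {{}})"
    by (rule partition_on_inj_image) (use part BijD(7)[OF g(1)] in \<open>auto simp: cone_partition_def\<close>)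
  moreover have "{} \<notin> (`) g ` cone n ` set ps"
    using part unfolding cone_partition_def partition_on_def by auto
  ultimately have "partition_on ?C (cone n ` set ?qs)"
    unfolding imgs using BijD(6)[OF g(1)] by simp
  moreover have "set ?qs \<subseteq> {1..r} \<times> lists {..<n}"
    using qin by (simp only: set_map image_subset_iff) blast
  ultimately have "cone_partition n r ?qs" using dist unfolding cone_partition_def by blast
  moreover have "\<forall>s < length ps. \<forall>x \<in> infinite_words n.
      g (fst (ps ! s), snd (ps ! s) \<frown> x) = (fst (?qs ! s), snd (?qs ! s) \<frown> x)"
  proof (intro allI impI)
    fix s assume s: "s < length ps"
    then have "replaces n g (ps ! s) (q (ps ! s))" using q ps(1) nth_mem by blast
    then show "\<forall>x \<in> infinite_words n.
      g (fst (ps ! s), snd (ps ! s) \<frown> x) = (fst (?qs ! s), snd (?qs ! s) \<frown> x)"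
      using s unfolding replaces_def by simp
  qed
  moreover have "length ps = length ?qs" by simp
  ultimately have "\<exists>ps qs. cone_partition n r ps \<and> cone_partition n r qs \<and> length ps = length qs \<and>
      (\<forall>s < length ps. \<forall>x \<in> infinite_words n.
         g (fst (ps ! s), snd (ps ! s) \<frown> x) = (fst (qs ! s), snd (qs ! s) \<frown> x))"
    using part by meson
  then show "g \<in> carrier (Higman_Thompson n r)"
    using g(1) prefix_replacing_homeomorphic[OF g] unfolding Higman_Thompson_def by simp
qed

section \<open>Normalizers and outer automorphisms\<close>

lemma (in group) cancel_left:
  assumes "h \<in> carrier G" "z \<in> carrier G"
  shows "inv h \<otimes> (h \<otimes> z) = z" "h \<otimes> (inv h \<otimes> z) = z"
  using assms by (simp_all add: m_assoc[symmetric])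

lemma (in group) conj_hom:
  assumes "x \<in> carrier G" "y \<in> carrier G" "h \<in> carrier G"
  shows "(h \<otimes> x \<otimes> inv h) \<otimes> (h \<otimes> y \<otimes> inv h) = h \<otimes> (x \<otimes> y) \<otimes> inv h"
  using assms by (simp add: m_assoc cancel_left)

text \<open>
  Conjugation on \<open>S\<close> by elements of the whole group: \<open>S\<close> will be a subgroup and the elements
  will normalize it.
\<close>
definition conj_on :: "('a, 'b) monoid_scheme \<Rightarrow> 'a set \<Rightarrow> 'a \<Rightarrow> 'a \<Rightarrow> 'a" where
  "conj_on G S h = (\<lambda>x \<in> S. h \<otimes>\<^bsub>G\<^esub> x \<otimes>\<^bsub>G\<^esub> inv\<^bsub>G\<^esub> h)"

lemma (in group) conj_on_mult:
  assumes "S \<subseteq> carrier G" "h \<in> carrier G" "k \<in> carrier G"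
    and "\<And>s. s \<in> S \<Longrightarrow> k \<otimes> s \<otimes> inv k \<in> S"
  shows "compose S (conj_on G S h) (conj_on G S k) = conj_on G S (h \<otimes> k)"
proof
  fix x
  show "compose S (conj_on G S h) (conj_on G S k) x = conj_on G S (h \<otimes> k) x"
  proof (cases "x \<in> S")
    case True
    then have "x \<in> carrier G" using assms(1) by blast
    moreover have "compose S (conj_on G S h) (conj_on G S k) x = h \<otimes> (k \<otimes> x \<otimes> inv k) \<otimes> inv h"
      using True assms(4)[OF True] by (simp add: conj_on_def compose_eq)
    ultimately show ?thesis
      using True assms(2,3) by (simp add: conj_on_def inv_mult_group m_assoc)
  next
    case False then show ?thesis by (simp add: conj_on_def compose_def)
  qed
qed

lemma (in group) conj_on_auto:
  assumes S: "subgroup S G" and h: "h \<in> carrier G"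
    and n: "\<And>s. s \<in> S \<Longrightarrow> h \<otimes> s \<otimes> inv h \<in> S" "\<And>s. s \<in> S \<Longrightarrow> inv h \<otimes> s \<otimes> h \<in> S"
  shows "conj_on G S h \<in> auto (G\<lparr>carrier := S\<rparr>)"
proof -
  have sub: "S \<subseteq> carrier G" using S by (rule subgroup.subset)
  have "conj_on G S h \<in> hom (G\<lparr>carrier := S\<rparr>) (G\<lparr>carrier := S\<rparr>)"
  proof (rule homI)
    fix x y assume "x \<in> carrier (G\<lparr>carrier := S\<rparr>)" "y \<in> carrier (G\<lparr>carrier := S\<rparr>)"
    then have xy: "x \<in> S" "y \<in> S" by auto
    then have "x \<otimes> y \<in> S" using S by (simp add: subgroup.m_closed)
    moreover have "x \<in> carrier G" "y \<in> carrier G" using xy sub by auto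
    ultimately show "conj_on G S h (x \<otimes>\<^bsub>G\<lparr>carrier := S\<rparr>\<^esub> y) =
        conj_on G S h x \<otimes>\<^bsub>G\<lparr>carrier := S\<rparr>\<^esub> conj_on G S h y"
      using xy h by (simp add: conj_on_def conj_hom)
  qed (use n in \<open>simp add: conj_on_def\<close>)
  moreover have "bij_betw (conj_on G S h) S S"
  proof (rule bij_betw_byWitness[where f' = "\<lambda>s. inv h \<otimes> s \<otimes> h"])
    show "\<forall>s \<in> S. inv h \<otimes> conj_on G S h s \<otimes> h = s"
    proof
      fix s assume s: "s \<in> S"
      then have c: "s \<in> carrier G" using sub by blast
      have "inv h \<otimes> (h \<otimes> s \<otimes> inv h) \<otimes> h = s"
        using c h by (simp add: m_assoc cancel_left)
      then show "inv h \<otimes> conj_on G S h s \<otimes> h = s" using s by (simp add: conj_on_def)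
    qed
    show "\<forall>s \<in> S. conj_on G S h (inv h \<otimes> s \<otimes> h) = s"
    proof
      fix s assume s: "s \<in> S"
      then have c: "s \<in> carrier G" using sub by blast
      have "h \<otimes> (inv h \<otimes> s \<otimes> h) \<otimes> inv h = s"
        using c h by (simp add: m_assoc cancel_left)
      then show "conj_on G S h (inv h \<otimes> s \<otimes> h) = s" using s n(2) by (simp add: conj_on_def)
    qed
  qed (use n in \<open>auto simp: conj_on_def\<close>)
  ultimately show ?thesis by (auto simp: auto_def Bij_def conj_on_def)
qed

lemma (in group) inner_automorphisms_eq: "inner_automorphisms G = conj_on G (carrier G) ` carrier G"
  by (auto simp: inner_automorphisms_def conj_on_def)

lemma AutoGroup_mult:
  "a \<in> auto G \<Longrightarrow> b \<in> auto G \<Longrightarrow> a \<otimes>\<^bsub>AutoGroup G\<^esub> b = compose (carrier G) a b"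
  by (simp add: AutoGroup_def BijGroup_def auto_def)

lemma carrier_AutoGroup: "carrier (AutoGroup G) = auto G"
  by (simp add: AutoGroup_def)

lemma (in group) conj_on_carrier_auto:
  "h \<in> carrier G \<Longrightarrow> conj_on G (carrier G) h \<in> auto G"
  using conj_on_auto[OF subgroup_self] by simp

lemma (in group) conj_on_carrier_hom: "conj_on G (carrier G) \<in> hom G (AutoGroup G)"
  by (rule homI)
     (simp_all add: carrier_AutoGroup conj_on_carrier_auto AutoGroup_mult conj_on_mult)

text \<open>
  Conjugating the inner automorphism of \<open>g\<close> by an automorphism \<open>a\<close> gives that of \<open>a g\<close>.
\<close>
lemma (in group) normal_inner_automorphisms: "inner_automorphisms G \<lhd> AutoGroup G"
proof -
  interpret A: group "AutoGroup G" by (rule AutoGroup)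
  interpret c: group_hom G "AutoGroup G" "conj_on G (carrier G)"
    by (simp add: group_hom_def group_hom_axioms_def conj_on_carrier_hom AutoGroup)
  have sub: "subgroup (inner_automorphisms G) (AutoGroup G)"
    unfolding inner_automorphisms_eq by (rule c.img_is_subgroup)
  have comm: "a \<otimes>\<^bsub>AutoGroup G\<^esub> conj_on G (carrier G) g = conj_on G (carrier G) (a g) \<otimes>\<^bsub>AutoGroup G\<^esub> a"
    if a: "a \<in> auto G" and g: "g \<in> carrier G" for a g
  proof -
    have ah: "a \<in> hom G G" using a by (simp add: auto_def)
    interpret a: group_hom G G a
      using ah by (simp add: group_hom_def group_hom_axioms_def)
    have "compose (carrier G) a (conj_on G (carrier G) g) x =
        compose (carrier G) (conj_on G (carrier G) (a g)) a x" for x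
      using g by (cases "x \<in> carrier G") (simp_all add: compose_def conj_on_def)
    then show ?thesis
      using a g by (simp add: AutoGroup_mult conj_on_carrier_auto fun_eq_iff)
  qed
  have "a \<otimes>\<^bsub>AutoGroup G\<^esub> b \<otimes>\<^bsub>AutoGroup G\<^esub> inv\<^bsub>AutoGroup G\<^esub> a \<in> inner_automorphisms G"
    if a: "a \<in> carrier (AutoGroup G)" and b: "b \<in> inner_automorphisms G" for a b
  proof -
    obtain g where g: "g \<in> carrier G" "b = conj_on G (carrier G) g"
      using b unfolding inner_automorphisms_eq by blast
    have a': "a \<in> auto G" using a by (simp add: carrier_AutoGroup)
    then have ag: "a g \<in> carrier G" using g by (auto simp: auto_def hom_def)
    have "a \<otimes>\<^bsub>AutoGroup G\<^esub> b \<otimes>\<^bsub>AutoGroup G\<^esub> inv\<^bsub>AutoGroup G\<^esub> a = conj_on G (carrier G) (a g)"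
      using a comm[OF a' g(1)] c.hom_closed[OF ag] unfolding g(2) by (simp add: A.m_assoc)
    then show ?thesis using ag unfolding inner_automorphisms_eq by simp
  qed
  then show ?thesis using sub A.normal_inv_iff by blast
qed

lemma (in group) group_Out: "group (Out G)"
  unfolding Out_def by (rule normal.factorgroup_is_group[OF normal_inner_automorphisms])

text \<open>
  Conjugation maps the normalizer of \<open>S\<close> to the automorphisms of \<open>S\<close>. If \<open>\<phi> f\<close> acts like an
  element \<open>s\<close> of \<open>S\<close>, then \<open>s\<close> and \<open>\<phi> f\<close> differ by an element that commutes with all of \<open>S\<close>,
  so they are equal and \<open>\<phi> f\<close> lies in \<open>S\<close>.
\<close>
theorem normalizer_embeds_in_Out:
  assumes B: "group B" and S: "subgroup S B" and F: "group F" and \<phi>: "\<phi> \<in> hom F B"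
    and normalizes: "\<And>f s. f \<in> carrier F \<Longrightarrow> s \<in> S \<Longrightarrow> \<phi> f \<otimes>\<^bsub>B\<^esub> s \<otimes>\<^bsub>B\<^esub> inv\<^bsub>B\<^esub> \<phi> f \<in> S"
    and centralizer: "\<And>b. b \<in> carrier B \<Longrightarrow> (\<And>s. s \<in> S \<Longrightarrow> b \<otimes>\<^bsub>B\<^esub> s = s \<otimes>\<^bsub>B\<^esub> b) \<Longrightarrow> b = \<one>\<^bsub>B\<^esub>"
    and trivial: "\<And>f. f \<in> carrier F \<Longrightarrow> \<phi> f \<in> S \<Longrightarrow> f = \<one>\<^bsub>F\<^esub>"
  shows "\<exists>\<Phi>. \<Phi> \<in> hom F (Out (B\<lparr>carrier := S\<rparr>)) \<and> inj_on \<Phi> (carrier F)"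
proof -
  interpret B: group B by (rule B)
  interpret F: group F by (rule F)
  interpret \<phi>: group_hom F B \<phi> using \<phi> by (simp add: group_hom_def group_hom_axioms_def B F)
  let ?G = "B\<lparr>carrier := S\<rparr>"
  interpret G: group ?G by (rule subgroup.subgroup_is_group[OF S B])
  let ?A = "AutoGroup ?G" and ?I = "inner_automorphisms ?G"
  interpret I: normal ?I ?A by (rule G.normal_inner_automorphisms)
  let ?c = "\<lambda>f. conj_on B S (\<phi> f)"
  have sub: "S \<subseteq> carrier B" by (rule subgroup.subset[OF S])
  have inner: "?I = conj_on B S ` S"
    unfolding G.inner_automorphisms_eq
    by (rule image_cong) (simp_all add: conj_on_def B.m_inv_consistent[OF S])
  have c_auto: "?c f \<in> auto ?G" if f: "f \<in> carrier F" for f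
  proof (rule B.conj_on_auto[OF S \<phi>.hom_closed[OF f] normalizes[OF f]])
    fix s assume "s \<in> S"
    then show "inv\<^bsub>B\<^esub> \<phi> f \<otimes>\<^bsub>B\<^esub> s \<otimes>\<^bsub>B\<^esub> \<phi> f \<in> S"
      using normalizes[OF F.inv_closed[OF f]] f by simp
  qed
  have "?c \<in> hom F ?A"
  proof (rule homI)
    fix f g assume fg: "f \<in> carrier F" "g \<in> carrier F"
    then have "compose S (?c f) (?c g) = ?c (f \<otimes>\<^bsub>F\<^esub> g)"
      using B.conj_on_mult[OF sub _ _ normalizes[OF fg(2)]] by simp
    then show "?c (f \<otimes>\<^bsub>F\<^esub> g) = ?c f \<otimes>\<^bsub>?A\<^esub> ?c g"
      using AutoGroup_mult[OF c_auto[OF fg(1)] c_auto[OF fg(2)]] by simp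
  qed (simp add: carrier_AutoGroup c_auto)
  then have hom: "(\<lambda>f. ?I #>\<^bsub>?A\<^esub> ?c f) \<in> hom F (Out ?G)"
    unfolding Out_def using hom_compose[OF _ I.r_coset_hom_Mod] by (simp add: comp_def)
  interpret \<Phi>: group_hom F "Out ?G" "\<lambda>f. ?I #>\<^bsub>?A\<^esub> ?c f"
    using hom by (simp add: group_hom_def group_hom_axioms_def F G.group_Out)
  have "f = \<one>\<^bsub>F\<^esub>" if f: "f \<in> carrier F" and ker: "?I #>\<^bsub>?A\<^esub> ?c f = ?I" for f
  proof -
    have "?c f \<in> ?I #>\<^bsub>?A\<^esub> ?c f"
      using I.rcos_self[OF _ I.subgroup_axioms] c_auto[OF f] by (simp add: carrier_AutoGroup)
    then have "?c f \<in> ?I" unfolding ker .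
    then obtain s where s: "s \<in> S" "?c f = conj_on B S s" unfolding inner by blast
    have sB: "s \<in> carrier B" and fB: "\<phi> f \<in> carrier B" using s(1) sub f by auto
    have "inv\<^bsub>B\<^esub> s \<otimes>\<^bsub>B\<^esub> \<phi> f = \<one>\<^bsub>B\<^esub>"
    proof (rule centralizer)
      fix t assume t: "t \<in> S"
      then have tB: "t \<in> carrier B" using sub by blast
      have eq: "\<phi> f \<otimes>\<^bsub>B\<^esub> t \<otimes>\<^bsub>B\<^esub> inv\<^bsub>B\<^esub> \<phi> f = s \<otimes>\<^bsub>B\<^esub> t \<otimes>\<^bsub>B\<^esub> inv\<^bsub>B\<^esub> s"
        using fun_cong[OF s(2), of t] t by (simp add: conj_on_def)
      have "\<phi> f \<otimes>\<^bsub>B\<^esub> t = \<phi> f \<otimes>\<^bsub>B\<^esub> t \<otimes>\<^bsub>B\<^esub> inv\<^bsub>B\<^esub> \<phi> f \<otimes>\<^bsub>B\<^esub> \<phi> f"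
        using fB tB by (simp add: B.m_assoc)
      also have "\<dots> = s \<otimes>\<^bsub>B\<^esub> (t \<otimes>\<^bsub>B\<^esub> (inv\<^bsub>B\<^esub> s \<otimes>\<^bsub>B\<^esub> \<phi> f))"
        unfolding eq using sB tB fB by (simp add: B.m_assoc)
      finally have "inv\<^bsub>B\<^esub> s \<otimes>\<^bsub>B\<^esub> (\<phi> f \<otimes>\<^bsub>B\<^esub> t) = t \<otimes>\<^bsub>B\<^esub> (inv\<^bsub>B\<^esub> s \<otimes>\<^bsub>B\<^esub> \<phi> f)"
        using sB tB fB by (simp add: B.m_assoc[symmetric])
      then show "inv\<^bsub>B\<^esub> s \<otimes>\<^bsub>B\<^esub> \<phi> f \<otimes>\<^bsub>B\<^esub> t = t \<otimes>\<^bsub>B\<^esub> (inv\<^bsub>B\<^esub> s \<otimes>\<^bsub>B\<^esub> \<phi> f)"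
        using sB tB fB by (simp add: B.m_assoc)
    qed (use sB fB in simp)
    then have "\<phi> f = s" using sB fB by (metis B.inv_closed B.inv_equality B.inv_inv)
    then show ?thesis using trivial[OF f] s(1) by simp
  qed
  then have "inj_on (\<lambda>f. ?I #>\<^bsub>?A\<^esub> ?c f) (carrier F)"
    by (subst \<Phi>.inj_on_one_iff) (simp add: Out_def)
  then show ?thesis using hom by blast
qed

lemma injective_hom_image:
  assumes F: "group F" and K: "group K" and \<Phi>: "\<Phi> \<in> hom F K" "inj_on \<Phi> (carrier F)"
  shows "\<exists>H. subgroup H K \<and> K\<lparr>carrier := H\<rparr> \<cong> F"
proof (intro exI conjI)
  interpret \<Phi>: group_hom F K \<Phi> using \<Phi> F K by (simp add: group_hom_def group_hom_axioms_def)
  show "subgroup (\<Phi> ` carrier F) K" by (rule \<Phi>.img_is_subgroup)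
  have "\<Phi> \<in> iso F (K\<lparr>carrier := \<Phi> ` carrier F\<rparr>)"
    using \<Phi> by (auto simp: iso_def hom_def bij_betw_def)
  then have "F \<cong> K\<lparr>carrier := \<Phi> ` carrier F\<rparr>" by (rule is_isoI)
  then show "K\<lparr>carrier := \<Phi> ` carrier F\<rparr> \<cong> F" by (rule group.iso_sym[OF F])
qed

section \<open>Block maps normalize the Higman--Thompson group\<close>

lemma BijGroup_simps:
  "carrier (BijGroup S) = Bij S" "\<one>\<^bsub>BijGroup S\<^esub> = (\<lambda>x \<in> S. x)"
  "f \<in> Bij S \<Longrightarrow> g \<in> Bij S \<Longrightarrow> f \<otimes>\<^bsub>BijGroup S\<^esub> g = compose S f g"
  by (simp_all add: BijGroup_def)

lemma Higman_Thompson_eq: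
  "Higman_Thompson n r = BijGroup (cantor n r)\<lparr>carrier := carrier (Higman_Thompson n r)\<rparr>"
  by (simp add: Higman_Thompson_def)

lemma subgroup_Higman_Thompson:
  assumes n: "1 \<le> n"
  shows "subgroup (carrier (Higman_Thompson n r)) (BijGroup (cantor n r))"
  unfolding Higman_Thompson_carrier[OF n]
proof
  let ?C = "cantor n r"
  show "{g \<in> Bij ?C. prefix_replacing n r g} \<subseteq> carrier (BijGroup ?C)" by (auto simp: BijGroup_simps)
  show "f \<otimes>\<^bsub>BijGroup ?C\<^esub> g \<in> {g \<in> Bij ?C. prefix_replacing n r g}"
    if "f \<in> {g \<in> Bij ?C. prefix_replacing n r g}" "g \<in> {g \<in> Bij ?C. prefix_replacing n r g}" for f g
  proof -
    have fg: "f \<in> Bij ?C" "g \<in> Bij ?C" "prefix_replacing n r f" "prefix_replacing n r g"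
      using that by auto
    have "prefix_replacing n r (compose ?C f g)"
      by (rule prefix_replacing_cong[OF _ prefix_replacing_comp[OF BijD(1)[OF fg(2)] fg(4,3)]])
         (simp add: compose_eq)
    then show ?thesis using fg by (simp add: BijGroup_simps compose_Bij)
  qed
  have "replaces n (\<lambda>x \<in> ?C. x) (i, prefix 0 x) (i, [])" if "i \<in> {1..r}" for i x
    using that by (simp add: replaces_def)
  then have "prefix_replacing n r (\<lambda>x \<in> ?C. x)" unfolding prefix_replacing_def by blast
  then show "\<one>\<^bsub>BijGroup ?C\<^esub> \<in> {g \<in> Bij ?C. prefix_replacing n r g}"
    by (simp add: BijGroup_simps id_Bij)
  show "inv\<^bsub>BijGroup ?C\<^esub> g \<in> {g \<in> Bij ?C. prefix_replacing n r g}"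
    if "g \<in> {g \<in> Bij ?C. prefix_replacing n r g}" for g
  proof -
    have g: "g \<in> Bij ?C" "prefix_replacing n r g" using that by auto
    have "prefix_replacing n r (restrict (inv_into ?C g) ?C)"
      by (rule prefix_replacing_cong[OF _ prefix_replacing_inv_into[OF g]]) simp
    then show ?thesis using g by (simp add: inv_BijGroup restrict_inv_into_Bij)
  qed
qed

text \<open>
  The involution that exchanges the cones below \<open>u\<close> given by the letters \<open>a\<close> and \<open>b\<close>.
\<close>
definition swap_letters :: "nat \<Rightarrow> nat list \<Rightarrow> nat \<Rightarrow> nat \<Rightarrow> nat \<times> nat word \<Rightarrow> nat \<times> nat word" where
  "swap_letters i u a b = (\<lambda>(j, x).
     if j = i \<and> prefix (length u) x = u
     then (j, (u @ [Transposition.transpose a b (x (length u))]) \<frown> suffix (Suc (length u)) x) else (j, x))"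

lemma swap_letters_in:
  assumes "a < n" "b < n" "c \<in> cantor n r"
  shows "swap_letters i u a b c \<in> cantor n r"
proof -
  obtain j x where c: "c = (j, x)" by (cases c)
  have x: "x \<in> infinite_words n" "j \<in> {1..r}" using assms(3) c by auto
  then have "x (length u) < n" by (auto simp: infinite_words_def)
  then have "Transposition.transpose a b (x (length u)) < n" using assms by (auto simp: Transposition.transpose_def)
  moreover have "u \<in> lists {..<n}" if "prefix (length u) x = u"
    using subword_in_lists(1)[OF x(1), of 0 "length u"] that by simp
  ultimately show ?thesis using x unfolding c swap_letters_def by simp
qed

lemma swap_letters_involution: "swap_letters i u a b (swap_letters i u a b c) = c"
proof -
  obtain j x where c: "c = (j, x)" by (cases c)
  show ?thesis
  proof (cases "j = i \<and> prefix (length u) x = u")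
    case True
    have "x = (prefix (length u) x @ [x (length u)]) \<frown> suffix (Suc (length u)) x"
      using prefix_suffix[of x "Suc (length u)"] by (simp del: prefix_suffix[symmetric])
    then show ?thesis using True unfolding c swap_letters_def by simp
  next
    case False then show ?thesis unfolding c swap_letters_def by auto
  qed
qed

lemma swap_letters_Higman_Thompson:
  assumes n: "1 \<le> n" "a < n" "b < n"
  shows "restrict (swap_letters i u a b) (cantor n r) \<in> carrier (Higman_Thompson n r)"
proof -
  let ?C = "cantor n r"
  have "bij_betw (swap_letters i u a b) ?C ?C"
    by (rule bij_betw_byWitness[where f' = "swap_letters i u a b"])
       (use swap_letters_in[OF n(2,3)] in \<open>auto simp: swap_letters_involution simp del: cantor_iff\<close>)
  then have "restrict (swap_letters i u a b) ?C \<in> Bij ?C" by (simp add: Bij_def)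
  moreover have "prefix_replacing n r (swap_letters i u a b)"
    unfolding prefix_replacing_def
  proof (intro ballI)
    fix j x assume jx: "j \<in> {1..r}" "x \<in> infinite_words n"
    let ?m = "Suc (length u)"
    have pre: "prefix (length u) (prefix ?m x \<frown> y) = prefix (length u) x"
      "(prefix ?m x \<frown> y) (length u) = x (length u)" "suffix ?m (prefix ?m x \<frown> y) = y" for y
      by (simp_all add: nth_append)
    have "replaces n (swap_letters i u a b) (j, prefix ?m x)
        (j, if j = i \<and> prefix (length u) x = u then u @ [Transposition.transpose a b (x (length u))] else prefix ?m x)"
      unfolding replaces_def swap_letters_def fst_conv snd_conv prod.case pre
      by (cases "j = i \<and> prefix (length u) x = u") (simp_all only: if_True if_False simp_thms ball_triv)
    then show "\<exists>m b'. replaces n (swap_letters i u a b) (j, prefix m x) b'" by blast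
  qed
  then have "prefix_replacing n r (restrict (swap_letters i u a b) ?C)"
    by (rule prefix_replacing_cong[rotated]) simp
  ultimately show ?thesis unfolding Higman_Thompson_carrier[OF n(1)] by simp
qed

text \<open>
  Choose a prefix of \<open>d\<close> that \<open>c\<close> does not share, and change the next letter of \<open>d\<close>.
\<close>
lemma Higman_Thompson_separates:
  assumes n: "2 \<le> n" and c: "c \<in> cantor n r" "d \<in> cantor n r" "c \<noteq> d"
  shows "\<exists>g \<in> carrier (Higman_Thompson n r). g c = c \<and> g d \<noteq> d"
proof -
  obtain i x j z where cd: "c = (i, x)" "d = (j, z)" by (cases c; cases d)
  obtain N where N: "i \<noteq> j \<or> prefix N x \<noteq> prefix N z"
  proof (cases "i = j")
    case True
    then obtain k where "x k \<noteq> z k" using c(3) cd by auto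
    then have "prefix (Suc k) x \<noteq> prefix (Suc k) z" by simp
    then show thesis using that by blast
  qed (use that in blast)
  define u where "u = prefix N z"
  (* Any letter other than the one that d has at this place. *)
  define b where "b = (if z N = 0 then 1 else 0 :: nat)"
  have lt: "z N < n" "b < n" using c(2) n unfolding cd b_def by (auto simp: infinite_words_def)
  let ?g = "swap_letters j u (z N) b"
  have len: "length u = N" by (simp add: u_def)
  have "?g c = c" using N unfolding cd swap_letters_def len u_def by auto
  moreover have "?g d \<noteq> d"
  proof
    assume "?g d = d"
    then have "(u @ [b]) \<frown> suffix (Suc N) z = z" unfolding cd swap_letters_def len u_def by simp
    then have "((u @ [b]) \<frown> suffix (Suc N) z) N = z N" by simp
    then have "b = z N" using len by (simp add: nth_append)
    then show False by (simp add: b_def split: if_splits)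
  qed
  ultimately show ?thesis
    using swap_letters_Higman_Thompson[of n "z N" b j u r] lt n c(1,2) by (intro bexI[of _ "restrict ?g (cantor n r)"]) auto
qed

text \<open>
  If \<open>b\<close> moves \<open>c\<close>, then some \<open>s\<close> in the group fixes \<open>c\<close> and moves \<open>b c\<close>, whereas commuting with
  \<open>s\<close> would give \<open>s (b c) = b (s c) = b c\<close>.
\<close>
lemma Higman_Thompson_centralizer:
  assumes n: "2 \<le> n" and b: "b \<in> Bij (cantor n r)"
    and comm: "\<And>s. s \<in> carrier (Higman_Thompson n r) \<Longrightarrow> compose (cantor n r) b s = compose (cantor n r) s b"
  shows "b = (\<lambda>x \<in> cantor n r. x)"
proof (rule extensionalityI)
  show "b \<in> extensional (cantor n r)" by (rule Bij_imp_extensional[OF b])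
  fix c assume c: "c \<in> cantor n r"
  have bc: "b c \<in> cantor n r" by (rule BijD(2)[OF b c])
  have "b c = c"
  proof (rule ccontr)
    assume "b c \<noteq> c"
    then obtain s where s: "s \<in> carrier (Higman_Thompson n r)" "s c = c" "s (b c) \<noteq> b c"
      using Higman_Thompson_separates[OF n c bc] by metis
    have "b (s c) = s (b c)" using fun_cong[OF comm[OF s(1)], of c] c by (simp add: compose_eq)
    then show False using s by simp
  qed
  then show "b c = (\<lambda>x \<in> cantor n r. x) c" using c by simp
qed simp

definition block_map :: "nat \<Rightarrow> nat \<Rightarrow> (bool list \<Rightarrow> bool list) \<Rightarrow> nat \<times> nat word \<Rightarrow> nat \<times> nat word" where
  "block_map n r \<phi> = restrict (\<lambda>(i, x). (i, on_blocks \<phi> x)) (cantor n r)"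

lemma block_map_apply [simp]:
  "i \<in> {1..r} \<Longrightarrow> x \<in> infinite_words n \<Longrightarrow> block_map n r \<phi> (i, x) = (i, on_blocks \<phi> x)"
  by (simp add: block_map_def)

lemma block_map_Bij:
  assumes n: "2 \<le> n" and \<phi>: "\<phi> \<in> tree_maps"
  shows "block_map n r \<phi> \<in> Bij (cantor n r)"
proof -
  have "bij_betw (block_map n r \<phi>) (cantor n r) (cantor n r)"
    by (rule bij_betw_byWitness[where f' = "block_map n r (inv_into UNIV \<phi>)"])
       (use on_blocks_infinite_words[OF n] \<phi> tree_maps_inv[OF \<phi>] on_blocks_inv[OF \<phi>]
         in \<open>auto simp: cantor_def\<close>)
  then show ?thesis by (simp add: Bij_def block_map_def)
qed

lemma block_map_compose:
  assumes n: "2 \<le> n" and "\<phi> \<in> tree_maps" "\<psi> \<in> tree_maps"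
  shows "compose (cantor n r) (block_map n r \<phi>) (block_map n r \<psi>) = block_map n r (\<phi> \<circ> \<psi>)"
proof
  fix c
  show "compose (cantor n r) (block_map n r \<phi>) (block_map n r \<psi>) c = block_map n r (\<phi> \<circ> \<psi>) c"
  proof (cases "c \<in> cantor n r")
    case True
    then show ?thesis
      using assms on_blocks_infinite_words[OF n assms(3)]
      by (cases c) (simp add: compose_eq on_blocks_comp)
  qed (simp add: compose_def block_map_def)
qed

text \<open>
  Let \<open>z\<close> be the image of \<open>x\<close>, and let \<open>g\<close> replace a prefix of \<open>x\<close> by \<open>v\<close>. The two prefixes are
  followed by the same tail, so by synchronization the block map continues in the same way \<open>k\<close>
  on both sides, after outputs \<open>P\<close> and \<open>Q\<close>. By continuity of the inverse, every point near \<open>z\<close> is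
  the image of a point near \<open>x\<close>, so it has the form \<open>P \<frown> k y'\<close>, and it is sent to
  \<open>Q \<frown> k y'\<close>: this is a prefix replacement.
\<close>
lemma block_map_conj:
  assumes n: "2 \<le> n" and \<phi>: "\<phi> \<in> tree_maps"
    and g: "g \<in> cantor n r \<rightarrow> cantor n r" "prefix_replacing n r g"
  shows "prefix_replacing n r (\<lambda>c. block_map n r \<phi> (g (block_map n r (inv_into UNIV \<phi>) c)))"
  unfolding prefix_replacing_def
proof (intro ballI)
  fix i z assume iz: "i \<in> {1..r}" "z \<in> infinite_words n"
  let ?h = "on_blocks \<phi>" and ?h' = "on_blocks (inv_into UNIV \<phi>)"
  note \<phi>' = tree_maps_inv[OF \<phi>]
  define x where "x = ?h' z"
  have x: "x \<in> infinite_words n" unfolding x_def by (rule on_blocks_infinite_words[OF n \<phi>' iz(2)])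
  obtain m j v where rep: "replaces n g (i, prefix m x) (j, v)"
    using prefix_replacing_at_depth[OF g(2), of i x] iz x cantor_iff by blast
  obtain l k where sync: "\<And>p. \<exists>P. \<forall>y. ?h ((p @ prefix l (suffix m x)) \<frown> y) = P \<frown> k y"
    using synchronization[OF \<phi>, of "suffix m x"] by blast
  define e where "e = prefix l (suffix m x)"
  have e: "e \<in> lists {..<n}" unfolding e_def using x by simp
  obtain P Q where P: "\<And>y. ?h ((prefix m x @ e) \<frown> y) = P \<frown> k y"
    and Q: "\<And>y. ?h ((v @ e) \<frown> y) = Q \<frown> k y"
    using sync[of "prefix m x"] sync[of v] unfolding e_def by blast
  have pre: "prefix m x @ e = prefix (m + l) x" by (simp add: e_def subsequence_append)
  obtain N where N: "\<And>z'. agree_upto N z z' \<Longrightarrow> agree_upto (m + l) x (?h' z')"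
    using on_blocks_continuous[OF \<phi>', of z "m + l"] unfolding x_def by blast
  (* Points that agree with z this far have preimages near x, and begin with P. *)
  define K where "K = max N (length P)"
  define w where "w = prefix (K - length P) (k (suffix (m + l) x))"
  have "z = ?h x" unfolding x_def by (simp add: on_blocks_inv[OF \<phi>])
  also have "\<dots> = ?h ((prefix m x @ e) \<frown> suffix (m + l) x)" unfolding pre by simp
  finally have "z = P \<frown> k (suffix (m + l) x)" unfolding P .
  then have preK: "prefix K z = P @ w" by (simp add: w_def K_def)
  have "replaces n (\<lambda>c. block_map n r \<phi> (g (block_map n r (inv_into UNIV \<phi>) c)))
      (i, prefix K z) (j, Q @ w)"
    unfolding replaces_def fst_conv snd_conv
  proof
    fix y assume y: "y \<in> infinite_words n"
    define z' where "z' = prefix K z \<frown> y"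
    have z': "z' \<in> infinite_words n" using y iz by (simp add: z'_def)
    define x' where "x' = ?h' z'"
    have x': "x' \<in> infinite_words n" unfolding x'_def by (rule on_blocks_infinite_words[OF n \<phi>' z'])
    have "agree_upto N z z'" unfolding agree_upto_def z'_def K_def by simp
    then have "agree_upto (m + l) x x'" unfolding x'_def by (rule N)
    then have "prefix (m + l) x' = prefix m x @ e"
      unfolding pre agree_upto_def by (simp add: subsequence_def)
    moreover define y' where "y' = suffix (m + l) x'"
    ultimately have x'eq: "x' = (prefix m x @ e) \<frown> y'"
      using prefix_suffix[of x' "m + l"] by (simp del: prefix_suffix[symmetric])
    have y': "y' \<in> infinite_words n" using x' by (simp add: y'_def)
    have "?h x' = z'" unfolding x'_def by (rule on_blocks_inv(2)[OF \<phi>])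
    then have "P \<frown> k y' = P \<frown> w \<frown> y" unfolding x'eq P z'_def preK by simp
    then have ky: "k y' = w \<frown> y" by (simp del: conc_conc)
    have gx: "g (i, x') = (j, (v @ e) \<frown> y')"
      using replacesD[OF replaces_extend[OF rep e] y'] x'eq by simp
    have "g (i, x') \<in> cantor n r" using g(1) iz x' by (simp add: Pi_iff)
    then have "block_map n r \<phi> (g (i, x')) = (j, ?h ((v @ e) \<frown> y'))"
      unfolding gx by (simp only: cantor_iff block_map_apply)
    also have "\<dots> = (j, (Q @ w) \<frown> y)" unfolding Q ky by simp
    finally show "block_map n r \<phi> (g (block_map n r (inv_into UNIV \<phi>) (i, prefix K z \<frown> y))) = (j, (Q @ w) \<frown> y)"
      using iz z' unfolding x'_def z'_def by simp
  qed
  then show "\<exists>m b. replaces n (\<lambda>c. block_map n r \<phi> (g (block_map n r (inv_into UNIV \<phi>) c))) (i, prefix m z) b"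
    by blast
qed

lemma block_map_inv:
  assumes n: "2 \<le> n" and \<phi>: "\<phi> \<in> tree_maps"
  shows "inv\<^bsub>BijGroup (cantor n r)\<^esub> block_map n r \<phi> = block_map n r (inv_into UNIV \<phi>)"
proof (rule group.inv_equality[OF group_BijGroup])
  have "inv_into UNIV \<phi> \<circ> \<phi> = id" using \<phi> by (simp add: tree_maps_def bij_is_inj)
  moreover have "block_map n r id = (\<lambda>x \<in> cantor n r. x)"
    by (rule ext) (auto simp: block_map_def on_blocks_id restrict_def)
  ultimately show "block_map n r (inv_into UNIV \<phi>) \<otimes>\<^bsub>BijGroup (cantor n r)\<^esub> block_map n r \<phi>
      = \<one>\<^bsub>BijGroup (cantor n r)\<^esub>"
    using block_map_Bij[OF n] \<phi> tree_maps_inv[OF \<phi>] block_map_compose[OF n tree_maps_inv[OF \<phi>] \<phi>]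
    by (simp add: BijGroup_simps)
qed (use block_map_Bij[OF n] \<phi> tree_maps_inv[OF \<phi>] in \<open>simp_all add: BijGroup_simps\<close>)

lemma block_map_normalizes:
  assumes n: "2 \<le> n" and \<phi>: "\<phi> \<in> tree_maps" and g: "g \<in> carrier (Higman_Thompson n r)"
  shows "block_map n r \<phi> \<otimes>\<^bsub>BijGroup (cantor n r)\<^esub> g \<otimes>\<^bsub>BijGroup (cantor n r)\<^esub>
      inv\<^bsub>BijGroup (cantor n r)\<^esub> block_map n r \<phi> \<in> carrier (Higman_Thompson n r)"
proof -
  let ?C = "cantor n r"
  have n1: "1 \<le> n" using n by simp
  have g': "g \<in> Bij ?C" "prefix_replacing n r g" using g unfolding Higman_Thompson_carrier[OF n1] by auto
  note h = block_map_Bij[OF n \<phi>, of r] and h' = block_map_Bij[OF n tree_maps_inv[OF \<phi>], of r]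
  let ?f = "compose ?C (compose ?C (block_map n r \<phi>) g) (block_map n r (inv_into UNIV \<phi>))"
  have "?f \<in> Bij ?C" by (intro compose_Bij h h' g')
  moreover have "prefix_replacing n r ?f"
    by (rule prefix_replacing_cong[OF _ block_map_conj[OF n \<phi> BijD(1)[OF g'(1)] g'(2)]])
       (use BijD(2)[OF h'] in \<open>simp add: compose_eq\<close>)
  ultimately show ?thesis
    unfolding block_map_inv[OF n \<phi>] Higman_Thompson_carrier[OF n1]
    using h h' g' by (simp add: BijGroup_simps compose_Bij)
qed

text \<open>
  One point at which a block map replaces a prefix suffices.
\<close>
lemma block_map_Higman_Thompson:
  assumes n: "2 \<le> n" and r: "1 \<le> r" and \<phi>: "\<phi> \<in> tree_maps"
    and mem: "block_map n r \<phi> \<in> carrier (Higman_Thompson n r)"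
  shows "\<phi> = id"
proof -
  have pr: "prefix_replacing n r (block_map n r \<phi>)"
    using mem n by (subst (asm) Higman_Thompson_carrier) auto
  let ?x = "(\<lambda>_. 0) :: nat word"
  have x: "?x \<in> infinite_words n" using n by (intro const_infinite_words) simp
  then have "(1, ?x) \<in> cantor n r" using r by simp
  from prefix_replacing_at_depth[OF pr this] obtain m j v where
    rep: "replaces n (block_map n r \<phi>) (1, prefix m ?x) (j, v)" by blast
  have "on_blocks \<phi> (prefix m ?x \<frown> y) = v \<frown> y" if "y \<in> infinite_words n" for y
    using replacesD[OF rep that] that r x by simp
  then show ?thesis by (rule on_blocks_prefix_replacing[OF \<phi> n])
qed

section \<open>The embedding of Thompson's group F\<close>

theorem Thompson_F_embeds_in_Out:
  assumes n: "2 \<le> n" and r: "1 \<le> r"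
  shows "\<exists>\<Phi>. \<Phi> \<in> hom Thompson_F (Out (Higman_Thompson n r)) \<and> inj_on \<Phi> (carrier Thompson_F)"
proof -
  let ?B = "BijGroup (cantor n r)" and ?S = "carrier (Higman_Thompson n r)"
  let ?\<phi> = "\<lambda>f. block_map n r (induced_tree_map f)"
  have "\<exists>\<Phi>. \<Phi> \<in> hom Thompson_F (Out (?B\<lparr>carrier := ?S\<rparr>)) \<and> inj_on \<Phi> (carrier Thompson_F)"
  proof (rule normalizer_embeds_in_Out[where \<phi> = ?\<phi>])
    show "group ?B" by (rule group_BijGroup)
    show S: "subgroup ?S ?B" using n by (intro subgroup_Higman_Thompson) simp
    show "group Thompson_F" by (rule group_Thompson_F)
    show "?\<phi> \<in> hom Thompson_F ?B"
    proof (rule homI)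
      fix f g assume "f \<in> carrier Thompson_F" "g \<in> carrier Thompson_F"
      then show "?\<phi> (f \<otimes>\<^bsub>Thompson_F\<^esub> g) = ?\<phi> f \<otimes>\<^bsub>?B\<^esub> ?\<phi> g"
        by (simp add: Thompson_F_mult induced_tree_map_compose BijGroup_simps block_map_Bij[OF n]
            induced_tree_map_in_tree_maps block_map_compose[OF n])
    qed (simp add: BijGroup_simps block_map_Bij[OF n] induced_tree_map_in_tree_maps)
    show "?\<phi> f \<otimes>\<^bsub>?B\<^esub> s \<otimes>\<^bsub>?B\<^esub> inv\<^bsub>?B\<^esub> ?\<phi> f \<in> ?S" if "f \<in> carrier Thompson_F" "s \<in> ?S" for f s
      using that block_map_normalizes[OF n] induced_tree_map_in_tree_maps by blast
    show "b = \<one>\<^bsub>?B\<^esub>" if b: "b \<in> carrier ?B" and "\<And>s. s \<in> ?S \<Longrightarrow> b \<otimes>\<^bsub>?B\<^esub> s = s \<otimes>\<^bsub>?B\<^esub> b" for b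
    proof -
      have "b \<in> Bij (cantor n r)" using b by (simp add: BijGroup_simps)
      moreover have "s \<in> Bij (cantor n r)" if "s \<in> ?S" for s
        using that subgroup.subset[OF S] by (auto simp: BijGroup_simps)
      ultimately show ?thesis
        using Higman_Thompson_centralizer[OF n, of b r] that(2) by (simp add: BijGroup_simps)
    qed
    show "f = \<one>\<^bsub>Thompson_F\<^esub>" if f: "f \<in> carrier Thompson_F" and "?\<phi> f \<in> ?S" for f
    proof -
      have one: "\<one>\<^bsub>Thompson_F\<^esub> \<in> carrier Thompson_F" by (rule monoid.one_closed[OF group.is_monoid[OF group_Thompson_F]])
      have "induced_tree_map f = id"
        by (rule block_map_Higman_Thompson[OF n r induced_tree_map_in_tree_maps[OF f] that(2)])
      also have "id = induced_tree_map \<one>\<^bsub>Thompson_F\<^esub>"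
      proof
        fix w
        have "\<one>\<^bsub>Thompson_F\<^esub> (centre w) = centre w"
          using centre_bounds[of w] by (simp add: Thompson_F_def BijGroup_def)
        then show "id w = induced_tree_map \<one>\<^bsub>Thompson_F\<^esub> w"
          using induced_tree_map_eqI[OF one] by simp
      qed
      finally show ?thesis by (rule induced_tree_map_inj[OF f one])
    qed
  qed
  then show ?thesis by (simp only: Higman_Thompson_eq[symmetric])
qed

theorem theorem1p2:
  fixes n r :: nat
  assumes "n \<ge> 2" and "1 \<le> r" and "r \<le> n - 1"
  shows "(\<exists>H. subgroup H (Out (Higman_Thompson n r)) \<and>
              (Out (Higman_Thompson n r))\<lparr>carrier := H\<rparr> \<cong> Thompson_F) \<and>
         (\<forall>K :: ('k, 'm) monoid_scheme. group K \<and> K \<cong> Out (Higman_Thompson n r) \<longrightarrow>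
            (\<exists>H. subgroup H K \<and> K\<lparr>carrier := H\<rparr> \<cong> Thompson_F))"
proof (intro conjI allI impI)
  let ?O = "Out (Higman_Thompson n r)"
  obtain \<Phi> where \<Phi>: "\<Phi> \<in> hom Thompson_F ?O" "inj_on \<Phi> (carrier Thompson_F)"
    using Thompson_F_embeds_in_Out[OF assms(1,2)] by blast
  have "group (Higman_Thompson n r)"
    using subgroup.subgroup_is_group[OF subgroup_Higman_Thompson group_BijGroup, of n r] assms(1)
    by (simp add: Higman_Thompson_eq[symmetric])
  then have O: "group ?O" by (rule group.group_Out)
  show "\<exists>H. subgroup H ?O \<and> ?O\<lparr>carrier := H\<rparr> \<cong> Thompson_F"
    by (rule injective_hom_image[OF group_Thompson_F O \<Phi>])
  fix K :: "('k, 'm) monoid_scheme" assume K: "group K \<and> K \<cong> ?O"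
  then have "?O \<cong> K" by (simp add: group.iso_sym)
  then obtain \<theta> where \<theta>: "\<theta> \<in> iso ?O K" by (auto simp: is_iso_def)
  have "\<theta> \<in> hom ?O K" using \<theta> by (simp add: iso_def)
  then have "\<theta> \<circ> \<Phi> \<in> hom Thompson_F K" by (rule hom_compose[OF \<Phi>(1)])
  moreover have "inj_on (\<theta> \<circ> \<Phi>) (carrier Thompson_F)"
  proof (rule comp_inj_on[OF \<Phi>(2)])
    have "\<Phi> ` carrier Thompson_F \<subseteq> carrier ?O" using \<Phi>(1) by (auto simp: hom_def)
    moreover have "inj_on \<theta> (carrier ?O)" using \<theta> by (simp add: iso_def bij_betw_def)
    ultimately show "inj_on \<theta> (\<Phi> ` carrier Thompson_F)" by (rule inj_on_subset[rotated])
  qed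
  ultimately show "\<exists>H. subgroup H K \<and> K\<lparr>carrier := H\<rparr> \<cong> Thompson_F"
    using injective_hom_image[OF group_Thompson_F] K by blast
qed

end
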